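(* For every $n\ge1$, the classical Krull dimension of $\mathbb{S}_n$ is $2n$.
   Context: $K$ is a field. $\mathbb{S}_n$ is the $K$-algebra generated by $x_1,\dots,x_n,y_1,\dots,y_n$ subject to the defining relations $y_ix_i=1$ for all $i$, and $[x_i,y_j]=[x_i,x_j]=[y_i,y_j]=0$ for all $i\ne j$. The classical Krull dimension of a ring is the supremum of lengths $s$ of strictly ascending chains $\mathfrak p_0\subset\mathfrak p_1\subset\cdots\subset\mathfrak p_s$ of (two-sided) prime ideals. *)

theory Defs
  imports "HOL-Algebra.QuotRing" "HOL-Algebra.Ideal_Product" "HOL-Library.Extended_Nat"
begin

datatype gen = X nat | Y nat

definition letters :: "nat \<Rightarrow> gen set" where
  "letters n = {X i | i. 1 \<le> i \<and> i \<le> n} \<union> {Y i | i. 1 \<le> i \<and> i \<le> n}"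

text \<open>The free associative K-algebra K<x_1..x_n,y_1..y_n>: finitely supported
  K-valued functions on words over the letters, with concatenation (convolution) product.\<close>
definition free_alg :: "nat \<Rightarrow> (gen list \<Rightarrow> 'k::field) ring" where
  "free_alg n = \<lparr> carrier = {f. finite {w. f w \<noteq> 0} \<and> (\<forall>w. f w \<noteq> 0 \<longrightarrow> set w \<subseteq> letters n)},
                  mult = (\<lambda>f g w. \<Sum>i\<le>length w. f (take i w) * g (drop i w)),
                  one = (\<lambda>w. if w = [] then 1 else 0),
                  zero = (\<lambda>w. 0),
                  add = (\<lambda>f g w. f w + g w) \<rparr>"

definition gen_el :: "gen \<Rightarrow> gen list \<Rightarrow> 'k::field" where
  "gen_el a = (\<lambda>w. if w = [a] then 1 else 0)"

definition commutator :: "('a, 'b) ring_scheme \<Rightarrow> 'a \<Rightarrow> 'a \<Rightarrow> 'a" where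
  "commutator R a b = (a \<otimes>\<^bsub>R\<^esub> b) \<ominus>\<^bsub>R\<^esub> (b \<otimes>\<^bsub>R\<^esub> a)"

definition S_rels :: "nat \<Rightarrow> (gen list \<Rightarrow> 'k::field) set" where
  "S_rels n =
     {(gen_el (Y i) \<otimes>\<^bsub>free_alg n\<^esub> gen_el (X i)) \<ominus>\<^bsub>free_alg n\<^esub> \<one>\<^bsub>free_alg n\<^esub> | i. 1 \<le> i \<and> i \<le> n}
   \<union> {commutator (free_alg n) (gen_el (X i)) (gen_el (Y j)) | i j.
        1 \<le> i \<and> i \<le> n \<and> 1 \<le> j \<and> j \<le> n \<and> i \<noteq> j}
   \<union> {commutator (free_alg n) (gen_el (X i)) (gen_el (X j)) | i j.
        1 \<le> i \<and> i \<le> n \<and> 1 \<le> j \<and> j \<le> n \<and> i \<noteq> j}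
   \<union> {commutator (free_alg n) (gen_el (Y i)) (gen_el (Y j)) | i j.
        1 \<le> i \<and> i \<le> n \<and> 1 \<le> j \<and> j \<le> n \<and> i \<noteq> j}"

definition S_alg :: "nat \<Rightarrow> (gen list \<Rightarrow> 'k::field) set ring" where
  "S_alg n = free_alg n Quot (genideal (free_alg n) (S_rels n))"

definition nc_prime_ideal :: "'a set \<Rightarrow> ('a, 'b) ring_scheme \<Rightarrow> bool" where
  "nc_prime_ideal P R \<longleftrightarrow> ideal P R \<and> P \<noteq> carrier R \<and>
     (\<forall>I J. ideal I R \<longrightarrow> ideal J R \<longrightarrow> ideal_prod R I J \<subseteq> P \<longrightarrow> I \<subseteq> P \<or> J \<subseteq> P)"

definition classical_krull_dim :: "('a, 'b) ring_scheme \<Rightarrow> enat" where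
  "classical_krull_dim R = Sup {enat s | s. \<exists>P :: nat \<Rightarrow> 'a set.
      (\<forall>i\<le>s. nc_prime_ideal (P i) R) \<and> (\<forall>i<s. P i \<subset> P (Suc i))}"

end

theory Submission
  imports Defs "HOL-Library.Poly_Mapping" "HOL-Library.Function_Algebras"
begin

text \<open>
  Normal forms of words identify \<open>S_n\<close> with the monoid algebra of the \<open>n\<close>-th power of the bicyclic
  monoid. Put \<open>e_i = 1 - x_i y_i\<close>, and for a prime \<open>P\<close> let \<open>C\<close> be the set of all \<open>i\<close> with
  \<open>e_i \<in> P\<close>. Modulo \<open>P\<close>, the variables \<open>x_i\<close>, \<open>y_i\<close> with \<open>i \<in> C\<close> are inverse to each other and
  central.

  Upper bound: along a chain of primes, \<open>C\<close> grows at most \<open>n\<close> times. At a step \<open>P \<subset> P'\<close> where \<open>C\<close>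
  is constant there is a polynomial in the commuting \<open>x_i\<close> lying in \<open>P'\<close> and regular modulo \<open>P\<close>.
  Any \<open>n + 1\<close> such polynomials are algebraically dependent, and the relation, read along the chain,
  puts a nonzero constant into a prime. So there are at most \<open>n\<close> steps of this kind either.

  Lower bound: replace the bicyclic factors one after the other first by the integers and then by
  the trivial monoid. The kernels of the resulting maps of monoid algebras form a strict chain of
  \<open>2 n + 1\<close> ideals. They are prime because every nonzero ideal of such a quotient contains \<open>d E\<close>
  for a nonzero Laurent polynomial \<open>d\<close>, where \<open>E\<close> is the product of the remaining \<open>e_i\<close>.
\<close>

section \<open>Monoid algebras of powers of the bicyclic monoid\<close>

abbreviation lookup :: "('a \<Rightarrow>\<^sub>0 'b::zero) \<Rightarrow> 'a \<Rightarrow> 'b" where "lookup \<equiv> Poly_Mapping.lookup"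
abbreviation single :: "'a \<Rightarrow> 'b \<Rightarrow> ('a \<Rightarrow>\<^sub>0 'b::zero)" where "single \<equiv> Poly_Mapping.single"
abbreviation keys :: "('a \<Rightarrow>\<^sub>0 'b::zero) \<Rightarrow> 'a set" where "keys \<equiv> Poly_Mapping.keys"

lemma poly_mapping_sum_singles:
  fixes a :: "'a \<Rightarrow>\<^sub>0 'b::comm_monoid_add"
  shows "a = (\<Sum>m\<in>keys a. single m (lookup a m))"
proof (rule poly_mapping_eqI)
  fix k
  have "(\<Sum>m\<in>keys a. lookup (single m (lookup a m)) k)
      = (\<Sum>m\<in>keys a. if m = k then lookup a k else 0)"
    by (intro sum.cong) (auto simp: lookup_single when_def)
  also have "\<dots> = lookup a k" by (auto simp: in_keys_iff)
  finally show "lookup a k = lookup (\<Sum>m\<in>keys a. single m (lookup a m)) k"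
    by (simp add: lookup_sum)
qed

text \<open>Statements additive in \<open>a\<close> need checking on single monomials only; most
  algebra identities below are reduced this way.\<close>

lemma keys_induct [consumes 1, case_names zero single add]:
  fixes a :: "'a \<Rightarrow>\<^sub>0 'b::comm_monoid_add"
  assumes "keys a \<subseteq> K" "P 0" "\<And>m c. m \<in> K \<Longrightarrow> P (single m c)"
    "\<And>a b. P a \<Longrightarrow> P b \<Longrightarrow> P (a + b)"
  shows "P a"
proof -
  have "finite M \<Longrightarrow> M \<subseteq> K \<Longrightarrow> P (\<Sum>m\<in>M. single m (lookup a m))" for M
    by (induction M rule: finite_induct) (auto intro: assms)
  from this[of "keys a"] show ?thesis
    using assms(1) poly_mapping_sum_singles[of a] by simp
qed

section \<open>The bicyclic monoid and monomials in its copies\<close>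

datatype bic = Bic nat nat

instantiation bic :: monoid_add
begin

definition "0 = Bic 0 0"

text \<open>\<open>Bic a b\<close> stands for the element \<open>x^a y^b\<close> of the bicyclic monoid, where \<open>y x = 1\<close>.\<close>

fun plus_bic :: "bic \<Rightarrow> bic \<Rightarrow> bic" where
  "Bic a b + Bic c d = Bic (a + (c - b)) (d + (b - c))"

instance
proof
  fix p q r :: bic
  show "p + q + r = p + (q + r)" by (cases p; cases q; cases r) auto
  show "0 + p = p" "p + 0 = p" by (cases p; simp add: zero_bic_def)+
qed

end

text \<open>The homomorphism onto the integers that makes x and y inverse to each other. Two
  elements of the bicyclic monoid become equal in this quotient exactly if their degrees
  agree.\<close>

fun deg :: "bic \<Rightarrow> int" where "deg (Bic a b) = int a - int b"

lemma deg_0 [simp]: "deg 0 = 0" by (simp add: zero_bic_def)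

lemma deg_add: "deg (p + q) = deg p + deg q"
  by (cases p; cases q) auto

type_synonym monom = "nat \<Rightarrow> bic"

text \<open>Monomials are plain functions, so their sum is the pointwise one. For finite
  \<open>T\<close>, \<open>Mon T\<close> is the power of the bicyclic monoid with one factor for
  each element of \<open>T\<close>.\<close>

definition Mon :: "nat set \<Rightarrow> monom set" where "Mon T = {m. \<forall>i. i \<notin> T \<longrightarrow> m i = 0}"

definition loc :: "nat \<Rightarrow> bic \<Rightarrow> monom" where "loc i p = (\<lambda>j. if j = i then p else 0)"

lemma Mon_0 [simp]: "0 \<in> Mon T" by (simp add: Mon_def)

lemma Mon_add: "m \<in> Mon T \<Longrightarrow> m' \<in> Mon T \<Longrightarrow> m + m' \<in> Mon T" by (simp add: Mon_def)

lemma Mon_mono: "T \<subseteq> U \<Longrightarrow> m \<in> Mon T \<Longrightarrow> m \<in> Mon U" by (auto simp: Mon_def)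

lemma loc_Mon: "i \<in> T \<Longrightarrow> loc i p \<in> Mon T" by (auto simp: Mon_def loc_def)

lemma loc_add: "loc i p + loc i q = loc i (p + q)" by (auto simp: loc_def fun_eq_iff)

lemma Mon_commute: "m \<in> Mon T \<Longrightarrow> m' \<in> Mon U \<Longrightarrow> T \<inter> U = {} \<Longrightarrow> m + m' = m' + m"
proof
  fix i
  assume "m \<in> Mon T" "m' \<in> Mon U" "T \<inter> U = {}"
  then have "m i = 0 \<or> m' i = 0" by (auto simp: Mon_def)
  then show "(m + m') i = (m' + m) i" by auto
qed

text \<open>Coefficients lie in a commutative ring rather than a field because the lower bound also
  uses this algebra over the Laurent polynomials
  \<open>int \<Rightarrow>\<^sub>0 'k\<close>.\<close>

definition alg :: "nat set \<Rightarrow> (monom \<Rightarrow>\<^sub>0 'd::comm_ring_1) set" where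
  "alg T = {a. keys a \<subseteq> Mon T}"

lemma alg_single [intro]: "m \<in> Mon T \<Longrightarrow> single m c \<in> alg T"
  by (simp add: alg_def)

lemma alg_0 [simp]: "0 \<in> alg T" and alg_1 [simp]: "1 \<in> alg T"
  by (auto simp: alg_def simp flip: single_one)

lemma alg_add [intro]: "a \<in> alg T \<Longrightarrow> b \<in> alg T \<Longrightarrow> a + b \<in> alg T"
  using keys_add[of a b] by (auto simp: alg_def)

lemma keys_uminus: "keys (- a) = keys (a :: 'a \<Rightarrow>\<^sub>0 'd::ab_group_add)"
  by (auto simp: in_keys_iff)

lemma alg_uminus [intro]: "a \<in> alg T \<Longrightarrow> - a \<in> alg T"
  by (auto simp: alg_def keys_uminus)

lemma alg_diff [intro]: "a \<in> alg T \<Longrightarrow> b \<in> alg T \<Longrightarrow> a - b \<in> alg T"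
  using alg_add[of a T "- b"] by auto

lemma alg_mult [intro]: "a \<in> alg T \<Longrightarrow> b \<in> alg T \<Longrightarrow> a * b \<in> alg T"
  using keys_mult[of a b] by (auto simp: alg_def intro!: Mon_add)

lemma alg_mono: "T \<subseteq> U \<Longrightarrow> a \<in> alg T \<Longrightarrow> a \<in> alg U"
  using Mon_mono by (auto simp: alg_def)

lemma alg_induct [consumes 1, case_names zero single add]:
  assumes "a \<in> alg T" "P 0" "\<And>m c. m \<in> Mon T \<Longrightarrow> P (single m c)"
    "\<And>a b. P a \<Longrightarrow> P b \<Longrightarrow> P (a + b)"
  shows "P a"
  using assms(1) unfolding alg_def mem_Collect_eq
  by (rule keys_induct) (rule assms(2-4); assumption)+

text \<open>By biadditivity only monomials matter, and at every coordinate one of the two monomials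
  is trivial.\<close>

lemma alg_commute:
  assumes "a \<in> alg T" "b \<in> alg U" "T \<inter> U = {}"
  shows "a * b = b * a"
  using assms(1)
proof (induction rule: alg_induct)
  case (single m c)
  show ?case using assms(2)
  proof (induction rule: alg_induct)
    case (single m' c')
    then show ?case using Mon_commute[OF \<open>m \<in> Mon T\<close> single assms(3)]
      by (simp add: mult_single mult.commute)
  qed (auto simp: algebra_simps)
qed (auto simp: algebra_simps)

abbreviation scal :: "'d \<Rightarrow> (monom \<Rightarrow>\<^sub>0 'd::comm_ring_1)" where "scal c \<equiv> single 0 c"

lemma scal_alg: "scal c \<in> alg T" by auto

lemma scal_commute: "scal c * a = a * scal c"
proof -
  have "a \<in> alg UNIV" by (auto simp: alg_def Mon_def)
  then show ?thesis using alg_commute[OF scal_alg[of c "{}"]] by auto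
qed

abbreviation mon :: "monom \<Rightarrow> (monom \<Rightarrow>\<^sub>0 'd::comm_ring_1)" where "mon m \<equiv> single m 1"

lemma mon_mult: "mon m * mon m' = mon (m + m')" by (simp add: mult_single)

lemma single_eq_scal_mon: "single m c = scal c * mon m" by (simp add: mult_single)

section \<open>The idempotents 1 - x_i y_i and their products\<close>

definition idemp :: "nat \<Rightarrow> (monom \<Rightarrow>\<^sub>0 'd::comm_ring_1)" where
  "idemp i = 1 - mon (loc i (Bic 1 1))"

definition idemps :: "nat list \<Rightarrow> (monom \<Rightarrow>\<^sub>0 'd::comm_ring_1)" where
  "idemps js = prod_list (map idemp js)"

lemma idemps_Nil [simp]: "idemps [] = 1" and idemps_Cons [simp]: "idemps (j # js) = idemp j * idemps js"
  by (simp_all add: idemps_def)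

lemma idemp_alg: "i \<in> T \<Longrightarrow> idemp i \<in> alg T"
  unfolding idemp_def by (intro alg_diff alg_1 alg_single loc_Mon)

lemma idemps_alg: "set js \<subseteq> T \<Longrightarrow> idemps js \<in> alg T"
  by (induction js) (auto intro: idemp_alg)

lemma idemp_idemp: "idemp i * idemp i = (idemp i :: monom \<Rightarrow>\<^sub>0 'd::comm_ring_1)"
  by (simp add: idemp_def algebra_simps mon_mult loc_add)

lemma idemp_commute: "idemp i * idemp j = idemp j * (idemp i :: monom \<Rightarrow>\<^sub>0 'd::comm_ring_1)"
proof (cases "i = j")
  case False
  then show ?thesis
    by (intro alg_commute[of _ "{i}" _ "{j}"] idemp_alg) auto
qed auto

lemma idemp_idemps_commute: "idemp i * idemps js = idemps js * (idemp i :: monom \<Rightarrow>\<^sub>0 'd::comm_ring_1)"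
proof (induction js)
  case (Cons j js)
  have "idemp i * idemps (j # js) = idemp j * (idemp i * (idemps js :: monom \<Rightarrow>\<^sub>0 'd))"
    by (simp add: idemp_commute[of i j] flip: mult.assoc)
  then show ?case by (simp add: Cons mult.assoc)
qed simp

lemma idemp_idemps: "j \<in> set js \<Longrightarrow> idemp j * idemps js = (idemps js :: monom \<Rightarrow>\<^sub>0 'd::comm_ring_1)"
proof (induction js)
  case (Cons k js)
  show ?case
  proof (cases "j = k")
    case True
    then show ?thesis by (simp add: idemp_idemp flip: mult.assoc)
  next
    case False
    have "idemp j * (idemp k * idemps js) = idemp k * (idemp j * (idemps js :: monom \<Rightarrow>\<^sub>0 'd))"
      by (simp add: idemp_commute[of j k] flip: mult.assoc)
    with False Cons show ?thesis by simp
  qed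
qed simp

lemma idemps_idemp: "j \<in> set js \<Longrightarrow> idemps js * idemp j = (idemps js :: monom \<Rightarrow>\<^sub>0 'd::comm_ring_1)"
  by (metis idemp_idemps idemp_idemps_commute)

lemma idemps_idemps: "set ks \<subseteq> set js \<Longrightarrow> idemps ks * idemps js = (idemps js :: monom \<Rightarrow>\<^sub>0 'd::comm_ring_1)"
  by (induction ks) (auto simp: mult.assoc idemp_idemps)

text \<open>A factor x_j at the left end of the j-th coordinate is killed, since (1 - x_j y_j) x_j =
  x_j - x_j (y_j x_j) = 0.\<close>

lemma idemps_mon_eq_0:
  assumes "j \<in> set js" "m j = Bic (Suc a) b"
  shows "idemps js * mon m = (0 :: monom \<Rightarrow>\<^sub>0 'd::comm_ring_1)"
proof -
  have m: "m = loc j (Bic 1 0) + m(j := Bic a b)"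
    using assms(2) by (auto simp: loc_def fun_eq_iff)
  have 0: "idemp j * mon (loc j (Bic 1 0)) = (0 :: monom \<Rightarrow>\<^sub>0 'd)"
    by (simp add: idemp_def algebra_simps mon_mult loc_add)
  have "idemps js * mon m = idemps js * (idemp j * mon (loc j (Bic 1 0))) * (mon (m(j := Bic a b)) :: monom \<Rightarrow>\<^sub>0 'd)"
    by (subst m, subst mon_mult[symmetric], subst idemps_idemp[OF assms(1), symmetric]) (simp only: mult.assoc)
  then show ?thesis by (simp only: 0) simp
qed

text \<open>The mirror image: y_j (1 - x_j y_j) = 0.\<close>

lemma mon_idemps_eq_0:
  assumes "j \<in> set js" "m j = Bic a (Suc b)"
  shows "mon m * idemps js = (0 :: monom \<Rightarrow>\<^sub>0 'd::comm_ring_1)"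
proof -
  have m: "m = m(j := Bic a b) + loc j (Bic 0 1)"
    using assms(2) by (auto simp: loc_def fun_eq_iff)
  have 0: "mon (loc j (Bic 0 1)) * idemp j = (0 :: monom \<Rightarrow>\<^sub>0 'd)"
    by (simp add: idemp_def algebra_simps mon_mult loc_add)
  have "mon m * idemps js = mon (m(j := Bic a b)) * (mon (loc j (Bic 0 1)) * idemp j) * (idemps js :: monom \<Rightarrow>\<^sub>0 'd)"
    by (subst m, subst mon_mult[symmetric], subst idemp_idemps[OF assms(1), symmetric]) (simp only: mult.assoc)
  then show ?thesis by (simp only: 0) simp
qed

text \<open>If x^a y^b is not 1, then a > 0 and the left copy of the idempotent kills it, or b > 0
  and the right copy does.\<close>

lemma idemps_single_idemps_eq_0:
  assumes "j \<in> set js" "m j \<noteq> 0"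
  shows "idemps js * single m c * idemps js = (0 :: monom \<Rightarrow>\<^sub>0 'd::comm_ring_1)"
proof -
  obtain a b where ab: "m j = Bic a b" by (cases "m j")
  have "idemps js * (mon m * idemps js) = (0 :: monom \<Rightarrow>\<^sub>0 'd)"
  proof (cases a)
    case 0
    with assms ab obtain b' where "b = Suc b'" by (cases b) (auto simp: zero_bic_def)
    with ab have "mon m * idemps js = (0 :: monom \<Rightarrow>\<^sub>0 'd)"
      by (intro mon_idemps_eq_0[OF assms(1)]) simp
    then show ?thesis by simp
  next
    case (Suc a')
    with ab have "idemps js * mon m = (0 :: monom \<Rightarrow>\<^sub>0 'd)"
      by (intro idemps_mon_eq_0[OF assms(1)]) simp
    then show ?thesis by (simp flip: mult.assoc)
  qed
  then have "scal c * (idemps js * (mon m * idemps js)) = 0" by simp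
  moreover have "idemps js * single m c * idemps js = scal c * (idemps js * (mon m * (idemps js :: monom \<Rightarrow>\<^sub>0 'd)))"
    unfolding single_eq_scal_mon[of m c] mult.assoc[symmetric] scal_commute[of c "idemps js"] ..
  ultimately show ?thesis by simp
qed

lemma idemps_single_idemps:
  assumes "m \<in> Mon T" "T \<inter> set js = {}"
  shows "idemps js * single m c * idemps js = single m c * (idemps js :: monom \<Rightarrow>\<^sub>0 'd::comm_ring_1)"
proof -
  have "idemps js * single m c = single m c * (idemps js :: monom \<Rightarrow>\<^sub>0 'd)"
    by (rule alg_commute[of _ "set js" _ T]) (use assms in \<open>auto intro: idemps_alg\<close>)
  then show ?thesis by (simp add: mult.assoc idemps_idemps)
qed

text \<open>When the product is expanded, a term containing some x_j y_j keeps a positive power of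
  x_j and never becomes the trivial monomial. This shows in particular that \<open>idemps js\<close>
  is not zero over a nontrivial coefficient ring.\<close>

lemma lookup_idemps_0: "lookup (idemps js) 0 = (1 :: 'd::comm_ring_1)"
proof (induction js)
  case (Cons j js)
  have "0 \<notin> keys (mon (loc j (Bic 1 1)) * (idemps js :: monom \<Rightarrow>\<^sub>0 'd))"
  proof
    assume "0 \<in> keys (mon (loc j (Bic 1 1)) * (idemps js :: monom \<Rightarrow>\<^sub>0 'd))"
    then obtain k where "0 = loc j (Bic 1 1) + k"
      using keys_mult[of "mon (loc j (Bic 1 1))" "idemps js :: monom \<Rightarrow>\<^sub>0 'd"] by auto
    then have "0 = Bic 1 1 + k j" by (metis loc_def plus_fun_apply zero_fun_apply)
    then show False by (cases "k j") (auto simp: zero_bic_def)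
  qed
  then have "lookup (mon (loc j (Bic 1 1)) * (idemps js :: monom \<Rightarrow>\<^sub>0 'd)) 0 = 0"
    by (simp only: in_keys_iff not_not)
  then show ?case using Cons
    by (simp only: idemps_Cons idemp_def left_diff_distrib lookup_minus mult_1_left diff_zero)
qed (simp only: idemps_Nil lookup_one_zero)

lemma lookup_scal_mult: "lookup (scal c * a) m = c * lookup a m"
  by (simp add: mult_map_scale_conv_mult[symmetric] Poly_Mapping.map.rep_eq when_def)

section \<open>Prime ideals\<close>

text \<open>Monomials without any y. They commute, so elements supported on them are ordinary
  polynomials in the x_i.\<close>

definition XMon :: "nat set \<Rightarrow> monom set" where
  "XMon T = {m \<in> Mon T. \<forall>i. \<exists>a. m i = Bic a 0}"

text \<open>Primeness is stated with elements, \<open>a * s * b\<close> for all \<open>s\<close>,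
  instead of products of ideals; \<open>nc_prime_ideal_alg_ring_iff\<close> shows that both forms
  agree.\<close>

locale alg_prime =
  fixes T :: "nat set" and P :: "(monom \<Rightarrow>\<^sub>0 'k::field) set"
  assumes finite_T: "finite T"
    and P_sub: "P \<subseteq> alg T"
    and P_0: "0 \<in> P"
    and P_add: "a \<in> P \<Longrightarrow> b \<in> P \<Longrightarrow> a + b \<in> P"
    and P_lmult: "a \<in> P \<Longrightarrow> s \<in> alg T \<Longrightarrow> s * a \<in> P"
    and P_rmult: "a \<in> P \<Longrightarrow> s \<in> alg T \<Longrightarrow> a * s \<in> P"
    and one_notin_P: "1 \<notin> P"
    and P_prime: "a \<in> alg T \<Longrightarrow> b \<in> alg T \<Longrightarrow> (\<And>s. s \<in> alg T \<Longrightarrow> a * s * b \<in> P) \<Longrightarrow> a \<in> P \<or> b \<in> P"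
begin

lemma P_uminus: "a \<in> P \<Longrightarrow> - a \<in> P"
  using P_lmult[of a "-1"] alg_uminus[OF alg_1] by auto

lemma P_diff: "a \<in> P \<Longrightarrow> b \<in> P \<Longrightarrow> a - b \<in> P"
  using P_add[of a "- b"] P_uminus by auto

lemma P_sum: "(\<And>i. i \<in> I \<Longrightarrow> f i \<in> P) \<Longrightarrow> sum f I \<in> P"
  by (induction I rule: infinite_finite_induct) (auto intro: P_0 P_add)

lemma P_alg: "a \<in> P \<Longrightarrow> a \<in> alg T"
  using P_sub by auto

lemma P_prime_mon:
  assumes "a \<in> alg T" "b \<in> alg T" "\<And>m. m \<in> Mon T \<Longrightarrow> a * mon m * b \<in> P"
  shows "a \<in> P \<or> b \<in> P"
proof (rule P_prime[OF assms(1,2)])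
  fix s :: "monom \<Rightarrow>\<^sub>0 'k" assume "s \<in> alg T"
  then show "a * s * b \<in> P"
  proof (induction rule: alg_induct)
    case (single m c)
    have "a * single m c * b = scal c * (a * mon m * b)"
      unfolding single_eq_scal_mon[of m c] mult.assoc[symmetric] scal_commute[of c a] ..
    then show ?case using P_lmult[OF assms(3)[OF single]] scal_alg by metis
  qed (simp_all add: P_0 P_add algebra_simps)
qed

text \<open>Split a monomial into its part at \<open>j\<close> and the rest. The rest commutes with
  \<open>idemp j\<close> and the part at \<open>j\<close> commutes with \<open>idemps js\<close>, so
  if the whole product were in \<open>P\<close>, then so would be
  \<open>idemp j * s * idemps js\<close> for every \<open>s\<close>, and primeness applies.\<close>

lemma idemps_notin_P:
  assumes "set js \<subseteq> T" "distinct js" "\<And>j. j \<in> set js \<Longrightarrow> idemp j \<notin> P"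
  shows "idemps js \<notin> P"
  using assms
proof (induction js)
  case Nil
  then show ?case using one_notin_P by simp
next
  case (Cons j js)
  show ?case
  proof
    assume in_P: "idemps (j # js) \<in> P"
    have "idemp j \<in> P \<or> idemps js \<in> P"
    proof (rule P_prime_mon)
      show "idemp j \<in> alg T" "idemps js \<in> alg T"
        using Cons.prems by (auto intro: idemp_alg idemps_alg)
      fix m assume m: "m \<in> Mon T"
      let ?m' = "m(j := 0)" and ?l = "loc j (m j)"
      have m_eq: "m = ?m' + ?l" by (auto simp: loc_def fun_eq_iff)
      have m': "?m' \<in> Mon (T - {j})" using m by (auto simp: Mon_def)
      have l: "?l \<in> Mon {j}" by (simp add: loc_Mon)
      have 1: "idemp j * mon ?m' = mon ?m' * (idemp j :: monom \<Rightarrow>\<^sub>0 'k)"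
        by (rule alg_commute[of _ "{j}" _ "T - {j}"]) (use m' in \<open>auto intro: idemp_alg\<close>)
      have 2: "mon ?l * idemps js = idemps js * (mon ?l :: monom \<Rightarrow>\<^sub>0 'k)"
        by (rule alg_commute[of _ "{j}" _ "set js"]) (use l Cons.prems in \<open>auto intro: idemps_alg\<close>)
      have "idemp j * mon m * idemps js = idemp j * mon ?m' * (mon ?l * (idemps js :: monom \<Rightarrow>\<^sub>0 'k))"
        by (subst m_eq, subst mon_mult[symmetric]) (simp only: mult.assoc)
      also have "\<dots> = mon ?m' * idemps (j # js) * mon ?l"
        unfolding 1 2 by (simp add: mult.assoc)
      also have "\<dots> \<in> P"
        by (intro P_lmult P_rmult in_P alg_single) (use m' l Cons.prems in \<open>auto intro: Mon_mono[rotated]\<close>)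
      finally show "idemp j * mon m * idemps js \<in> P" .
    qed
    with Cons show False by auto
  qed
qed

definition C :: "nat set" where "C = {i \<in> T. idemp i \<in> P}"

lemma C_sub: "C \<subseteq> T" by (auto simp: C_def)

text \<open>Multiplying \<open>idemp i\<close> by x_i^a on the left and y_i^b on the right gives
  x_i^a y_i^b - x_i^(a+1) y_i^(b+1).\<close>

lemma mon_cong_step:
  assumes "i \<in> C" "m \<in> Mon T"
  shows "mon (m(i := Bic (Suc a) (Suc b))) - mon (m(i := Bic a b)) \<in> P"
proof -
  let ?u = "mon (m(i := Bic a 0)) :: monom \<Rightarrow>\<^sub>0 'k" and ?v = "mon (loc i (Bic 0 b)) :: monom \<Rightarrow>\<^sub>0 'k"
  have iT: "i \<in> T" and eP: "idemp i \<in> P" using assms by (auto simp: C_def)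
  have 1: "m(i := Bic a 0) + loc i (Bic 1 1) + loc i (Bic 0 b) = m(i := Bic (Suc a) (Suc b))"
    and 2: "m(i := Bic a 0) + loc i (Bic 0 b) = m(i := Bic a b)"
    by (auto simp: fun_eq_iff loc_def)
  have "?u * idemp i * ?v = ?u * ?v - ?u * mon (loc i (Bic 1 1)) * ?v"
    by (simp add: idemp_def algebra_simps)
  also have "\<dots> = mon (m(i := Bic a b)) - mon (m(i := Bic (Suc a) (Suc b)))"
    by (simp only: mon_mult 1 2)
  finally have *: "- (?u * idemp i * ?v) = mon (m(i := Bic (Suc a) (Suc b))) - mon (m(i := Bic a b))"
    by simp
  have "m(i := Bic a 0) \<in> Mon T" using assms iT by (auto simp: Mon_def)
  then have "- (?u * idemp i * ?v) \<in> P"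
    by (intro P_uminus P_lmult P_rmult eP alg_single loc_Mon iT)
  with * show ?thesis by simp
qed

lemma mon_cong_at:
  assumes "i \<in> C" "m \<in> Mon T" "deg p = deg q"
  shows "mon (m(i := p)) - mon (m(i := q)) \<in> P"
proof -
  have up: "mon (m(i := Bic (a + k) (b + k))) - mon (m(i := Bic a b)) \<in> P" for a b k
  proof (induction k)
    case 0
    then show ?case by (simp add: P_0)
  next
    case (Suc k)
    have "x - y + (y - z) = x - z" for x y z :: "monom \<Rightarrow>\<^sub>0 'k" by simp
    with P_add[OF mon_cong_step[OF assms(1,2), of "a + k" "b + k"] Suc] show ?case
      by (simp only: add_Suc_right)
  qed
  obtain a b c d where pq: "p = Bic a b" "q = Bic c d" by (cases p; cases q)
  show ?thesis
  proof (cases "a \<le> c")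
    case True
    with assms(3) pq have q: "q = Bic (a + (c - a)) (b + (c - a))" by auto
    from P_uminus[OF up[of a "c - a" b]] show ?thesis unfolding q pq(1) by simp
  next
    case False
    with assms(3) pq have p: "p = Bic (c + (a - c)) (d + (a - c))" by auto
    from up[of c "a - c" d] show ?thesis unfolding p pq(2) by simp
  qed
qed

lemma mon_cong_aux:
  assumes "finite D" "D \<subseteq> C" "m \<in> Mon T" "m' \<in> Mon T"
    "\<And>i. i \<notin> D \<Longrightarrow> m i = m' i" "\<And>i. i \<in> D \<Longrightarrow> deg (m i) = deg (m' i)"
  shows "mon m - mon m' \<in> P"
  using assms
proof (induction D arbitrary: m rule: finite_induct)
  case empty
  then have "m = m'" by auto
  then show ?case by (simp add: P_0)
next
  case (insert i D)
  have "mon (m(i := m' i)) - mon m' \<in> P"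
    by (rule insert.IH) (use insert.prems in \<open>auto simp: Mon_def\<close>)
  moreover have "mon (m(i := m i)) - mon (m(i := m' i)) \<in> P"
    by (rule mon_cong_at) (use insert.prems in auto)
  ultimately show ?case using P_add by fastforce
qed

lemma mon_cong:
  assumes "m \<in> Mon T" "m' \<in> Mon T"
    "\<And>i. i \<notin> C \<Longrightarrow> m i = m' i" "\<And>i. i \<in> C \<Longrightarrow> deg (m i) = deg (m' i)"
  shows "mon m - mon m' \<in> P"
  using mon_cong_aux[of C m m'] assms C_sub finite_subset[OF C_sub finite_T] by auto

text \<open>For \<open>m\<close> in \<open>Mon C\<close>, the monomials \<open>m + m'\<close> and
  \<open>m' + m\<close> agree outside \<open>C\<close>, where \<open>m\<close> is trivial, and have
  equal degrees inside \<open>C\<close>; hence they are congruent modulo \<open>P\<close>.\<close>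

lemma alg_C_central:
  assumes "f \<in> alg C" "s \<in> alg T"
  shows "f * s - s * f \<in> P"
  using assms(1)
proof (induction rule: alg_induct)
  case (single m c)
  show ?case using assms(2)
  proof (induction rule: alg_induct)
    case (single m' c')
    have "mon (m + m') - mon (m' + m) \<in> P"
      using \<open>m \<in> Mon C\<close> single Mon_mono[OF C_sub]
      by (intro mon_cong Mon_add) (auto simp: deg_add Mon_def)
    from P_lmult[OF this scal_alg, of "c * c'"] show ?case
      by (simp add: algebra_simps mult_single)
  next
    case (add a b)
    from P_add[OF add] show ?case by (simp add: algebra_simps)
  qed (simp add: P_0)
next
  case (add a b)
  from P_add[OF add] show ?case by (simp add: algebra_simps)
qed (simp add: P_0)

text \<open>Centrality modulo \<open>P\<close> turns \<open>f * s * b\<close> into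
  \<open>s * f * b\<close>, so the prime ideal behaves like a completely prime one for factors from
  \<open>alg C\<close>.\<close>

lemma alg_C_prime:
  assumes "f \<in> alg C" "b \<in> alg T" "f * b \<in> P"
  shows "f \<in> P \<or> b \<in> P"
proof (rule P_prime)
  show "f \<in> alg T" using assms C_sub alg_mono by blast
  fix s :: "monom \<Rightarrow>\<^sub>0 'k" assume s: "s \<in> alg T"
  have "s * (f * b) + (f * s - s * f) * b \<in> P"
    by (intro P_add P_lmult P_rmult alg_C_central assms s)
  then show "f * s * b \<in> P" by (simp add: algebra_simps)
qed (rule assms)

end

text \<open>
  Modulo a prime \<open>P\<close>, the idempotent \<open>E\<close> of the coordinates outside \<open>C\<close> cuts out the corner
  ring \<open>E A E\<close>, which consists of the elements \<open>g * E\<close> with \<open>g\<close> a Laurent polynomial in the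
  coordinates of \<open>C\<close>. So strict inclusions with the same \<open>C\<close> are witnessed by polynomials.
\<close>

lemma idemps_sandwich:
  assumes "p \<in> alg T" "C \<subseteq> T" "set js = T - C"
  obtains g :: "monom \<Rightarrow>\<^sub>0 'd::comm_ring_1" where "g \<in> alg C" "idemps js * p * idemps js = g * idemps js"
proof -
  have "\<exists>g \<in> alg C. idemps js * p * idemps js = g * (idemps js :: monom \<Rightarrow>\<^sub>0 'd)"
    using assms(1)
  proof (induction rule: alg_induct)
    case zero
    show ?case by (rule bexI[of _ 0]) auto
  next
    case (single m c)
    show ?case
    proof (cases "\<exists>j\<in>set js. m j \<noteq> 0")
      case True
      then have "idemps js * single m c * idemps js = (0 :: monom \<Rightarrow>\<^sub>0 'd)"
        using idemps_single_idemps_eq_0 by blast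
      then show ?thesis by (intro bexI[of _ 0]) auto
    next
      case False
      with single assms(3) have "m \<in> Mon C" unfolding Mon_def by auto
      then show ?thesis
        by (intro bexI[of _ "single m c"] idemps_single_idemps[of _ C] alg_single) (use assms in auto)
    qed
  next
    case (add a b)
    then obtain g h where "g \<in> alg C" "h \<in> alg C" "idemps js * a * idemps js = g * (idemps js :: monom \<Rightarrow>\<^sub>0 'd)"
      "idemps js * b * idemps js = h * (idemps js :: monom \<Rightarrow>\<^sub>0 'd)" by blast
    then show ?case by (intro bexI[of _ "g + h"]) (auto simp: algebra_simps)
  qed
  with that show ?thesis by blast
qed

lemma exists_poly_between:
  fixes P P' :: "(monom \<Rightarrow>\<^sub>0 'k::field) set"
  assumes "alg_prime T P" "alg_prime T P'" "P \<subset> P'" "alg_prime.C T P = alg_prime.C T P'"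
  obtains f where "keys f \<subseteq> XMon T" "f \<in> P'" "\<And>b. b \<in> alg T \<Longrightarrow> f * b \<in> P \<Longrightarrow> b \<in> P"
proof -
  interpret P: alg_prime T P by fact
  interpret P': alg_prime T P' by fact
  define js where "js = sorted_list_of_set (T - P.C)"
  have fin: "finite (T - P.C)" and fin_C: "finite P.C"
    using P.finite_T P.C_sub finite_subset by auto
  have js: "set js = T - P.C" "distinct js" unfolding js_def using fin by auto
  define E :: "monom \<Rightarrow>\<^sub>0 'k" where "E = idemps js"
  have E_P: "E \<notin> P" unfolding E_def by (rule P.idemps_notin_P) (use js in \<open>auto simp: P.C_def\<close>)
  have E_P': "E \<notin> P'" unfolding E_def
    by (rule P'.idemps_notin_P) (use js in \<open>auto simp: assms(4) P'.C_def\<close>)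
  have E_alg: "E \<in> alg T" unfolding E_def by (rule idemps_alg) (use js in auto)
  obtain a where a: "a \<in> P'" "a \<notin> P" using assms(3) by blast
  have aT: "a \<in> alg T" using a P'.P_alg by auto
  \<comment> \<open>Primeness is applied twice, to \<open>E\<close> and \<open>a\<close>, then to
    \<open>E * s * a\<close> and \<open>E\<close>. This moves the witness \<open>a\<close> into the
    corner cut out by \<open>E\<close> without entering \<open>P\<close>.\<close>
  obtain s where s: "s \<in> alg T" "E * s * a \<notin> P"
    using P.P_prime[OF E_alg aT] E_P a by blast
  obtain t where t: "t \<in> alg T" "E * s * a * t * E \<notin> P"
    using P.P_prime[of "E * s * a" E] E_P s E_alg aT by blast
  define p where "p = s * a * t"
  have p: "p \<in> P'" unfolding p_def by (intro P'.P_lmult P'.P_rmult s t a)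
  obtain g where g: "g \<in> alg P.C" "E * p * E = g * E"
    unfolding E_def by (rule idemps_sandwich[OF P'.P_alg[OF p] P.C_sub js(1)])
  have gE_P': "g * E \<in> P'" unfolding g(2)[symmetric] by (intro P'.P_lmult P'.P_rmult p E_alg)
  have "g * E \<notin> P" using t(2) g(2) unfolding p_def by (simp add: mult.assoc)
  then have gP: "g \<notin> P" using P.P_rmult E_alg by blast
  have gT: "g \<in> alg T" using g P.C_sub alg_mono by blast
  \<comment> \<open>\<open>N\<close> bounds all exponents of y_i with i in \<open>C\<close>
    occurring in \<open>g\<close>; multiplication by x_i^N for these i then removes every y.\<close>
  have "finite ((\<lambda>(m, i). case m i of Bic a b \<Rightarrow> b) ` (keys g \<times> P.C))" using fin_C by auto
  then obtain N where N: "\<forall>b \<in> (\<lambda>(m, i). case m i of Bic a b \<Rightarrow> b) ` (keys g \<times> P.C). b \<le> N"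
    using finite_nat_set_iff_bounded_le by blast
  have N: "b \<le> N" if "m \<in> keys g" "i \<in> P.C" "m i = Bic a b" for m i a b
  proof -
    have "(\<lambda>(m, i). case m i of Bic a b \<Rightarrow> b) (m, i) \<in> (\<lambda>(m, i). case m i of Bic a b \<Rightarrow> b) ` (keys g \<times> P.C)"
      using that by (intro imageI) auto
    with N have "(\<lambda>(m, i). case m i of Bic a b \<Rightarrow> b) (m, i) \<le> N" by blast
    with that(3) show ?thesis by simp
  qed
  define x y :: monom where "x = (\<lambda>i. if i \<in> P.C then Bic N 0 else 0)"
    and "y = (\<lambda>i. if i \<in> P.C then Bic 0 N else 0)"
  have xC: "x \<in> Mon P.C" and yC: "y \<in> Mon P.C" by (auto simp: Mon_def x_def y_def)
  define f where "f = g * mon x"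
  have f_keys: "keys f \<subseteq> XMon T"
  proof
    fix k assume "k \<in> keys f"
    then obtain m where m: "m \<in> keys g" "k = m + x"
      using keys_mult[of g "mon x"] by (auto simp: f_def)
    have mC: "m \<in> Mon P.C" using m g(1) by (auto simp: alg_def)
    have "\<exists>a. k i = Bic a 0" for i
    proof (cases "i \<in> P.C")
      case True
      obtain a b where ab: "m i = Bic a b" by (cases "m i")
      with N[OF m(1) True ab] True show ?thesis by (simp add: m(2) x_def)
    next
      case False
      with mC have "m i = 0" by (auto simp: Mon_def)
      with False show ?thesis by (simp add: m(2) x_def zero_bic_def)
    qed
    moreover have "k \<in> Mon T" unfolding m(2) using mC xC Mon_mono[OF P.C_sub] Mon_add by blast
    ultimately show "k \<in> XMon T" by (auto simp: XMon_def)
  qed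
  have fC: "f \<in> alg P.C" unfolding f_def using g xC by auto
  have "f * E = g * E * mon x"
  proof -
    have "mon x * E = E * mon x" unfolding E_def
      by (rule alg_commute[of _ "P.C" _ "set js"]) (use xC js in \<open>auto intro: idemps_alg\<close>)
    then show ?thesis unfolding f_def by (simp add: mult.assoc)
  qed
  also have "\<dots> \<in> P'" using xC Mon_mono[OF P.C_sub] by (intro P'.P_rmult gE_P') auto
  \<comment> \<open>\<open>E\<close> is not in \<open>P'\<close>, and \<open>f\<close> is regular
    modulo \<open>P'\<close> unless it lies in \<open>P'\<close>.\<close>
  finally have f_P': "f \<in> P'"
    using P'.alg_C_prime[OF fC[unfolded assms(4)] E_alg] E_P' by blast
  \<comment> \<open>Modulo \<open>P\<close> the monomial \<open>y\<close> is inverse to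
    \<open>x\<close>, so \<open>f * mon y\<close> is congruent to \<open>g\<close>, which is not in
    \<open>P\<close>.\<close>
  have "f \<notin> P"
  proof
    assume "f \<in> P"
    then have 1: "f * mon y \<in> P" using yC Mon_mono[OF P.C_sub] by (intro P.P_rmult) auto
    have "mon (x + y) - mon 0 \<in> P"
      using xC yC Mon_mono[OF P.C_sub] by (intro P.mon_cong Mon_add) (auto simp: x_def y_def zero_bic_def)
    then have 2: "g * (mon (x + y) - 1) \<in> P" using P.P_lmult[OF _ gT] by auto
    have "f * mon y - g * (mon (x + y) - 1) = g"
      by (simp add: f_def algebra_simps mon_mult)
    with P.P_diff[OF 1 2] gP show False by simp
  qed
  then have "b \<in> P" if "b \<in> alg T" "f * b \<in> P" for b
    using P.alg_C_prime[OF fC that] by blast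
  with f_keys f_P' that show ?thesis by blast
qed

section \<open>Chains of primes have length at most 2n\<close>

lemma exists_linear_relation:
  fixes g :: "'i \<Rightarrow> 'u \<Rightarrow> 'k::field"
  assumes "finite U" "finite I" "card U < card I"
  shows "\<exists>c. (\<exists>i\<in>I. c i \<noteq> 0) \<and> (\<forall>u\<in>U. (\<Sum>i\<in>I. c i * g i u) = 0)"
  using assms
proof (induction U arbitrary: I g rule: finite_induct)
  case empty
  then obtain i where "i \<in> I" by fastforce
  then show ?case by (intro exI[of _ "\<lambda>_. 1"]) auto
next
  case (insert u U)
  show ?case
  proof (cases "\<forall>i\<in>I. g i u = 0")
    case True
    then have "(\<Sum>i\<in>I. c i * g i u) = 0" for c by simp
    moreover obtain c where "\<exists>i\<in>I. c i \<noteq> 0" "\<forall>u\<in>U. (\<Sum>i\<in>I. c i * g i u) = 0"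
      using insert.IH[of I g] insert.prems insert.hyps by auto
    ultimately show ?thesis by blast
  next
    case False
    then obtain l where l: "l \<in> I" "g l u \<noteq> 0" by blast
    define J where "J = I - {l}"
    \<comment> \<open>Elimination with pivot \<open>g l u\<close>: the vectors \<open>h i\<close>
      vanish at \<open>u\<close>, so the induction hypothesis for \<open>U\<close> applies to
      them.\<close>
    define h where "h i v = g i v - g i u / g l u * g l v" for i v
    have "finite J" "card U < card J" using insert l by (auto simp: J_def)
    then obtain c where c: "\<exists>i\<in>J. c i \<noteq> 0" "\<forall>u\<in>U. (\<Sum>i\<in>J. c i * h i u) = 0"
      using insert.IH[of J h] by auto
    have hu: "h i u = 0" for i using l by (simp add: h_def)
    \<comment> \<open>Back substitution: the coefficient of the pivot is chosen so that the relation
      among the \<open>h i\<close> becomes one among the \<open>g i\<close>.\<close>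
    define d where "d i = (if i = l then - (\<Sum>i\<in>J. c i * g i u / g l u) else c i)" for i
    have "(\<Sum>i\<in>I. d i * g i v) = 0" if "v \<in> insert u U" for v
    proof -
      have "(\<Sum>i\<in>I. d i * g i v) = d l * g l v + (\<Sum>i\<in>J. d i * g i v)"
        unfolding J_def using insert.prems(1) l(1) by (rule sum.remove)
      also have "(\<Sum>i\<in>J. d i * g i v) = (\<Sum>i\<in>J. c i * g i v)"
        by (rule sum.cong) (auto simp: d_def J_def)
      also have "d l * g l v = - (\<Sum>i\<in>J. c i * (g i u / g l u * g l v))"
        by (simp add: d_def sum_distrib_right mult.assoc)
      also have "- (\<Sum>i\<in>J. c i * (g i u / g l u * g l v)) + (\<Sum>i\<in>J. c i * g i v) = (\<Sum>i\<in>J. c i * h i v)"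
        by (simp add: h_def right_diff_distrib sum_subtractf)
      also have "\<dots> = 0" using that c(2) hu by auto
      finally show ?thesis .
    qed
    moreover have "\<exists>i\<in>I. d i \<noteq> 0" using c(1) by (auto simp: d_def J_def)
    ultimately show ?thesis by blast
  qed
qed

text \<open>Each exponent is bounded separately, not the total degree: the number of monomials is
  then bounded by a plain power and the bounds add up under multiplication.\<close>

definition XBox :: "nat set \<Rightarrow> nat \<Rightarrow> monom set" where
  "XBox T d = {m \<in> Mon T. \<forall>i. \<exists>a\<le>d. m i = Bic a 0}"

lemma card_XBox:
  assumes "finite T"
  shows "finite (XBox T d)" "card (XBox T d) \<le> (d + 1) ^ card T"
proof -
  let ?F = "PiE T (\<lambda>_. {..d})" and ?h = "\<lambda>\<alpha> i. if i \<in> T then Bic (\<alpha> i) 0 else 0"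
  have fin: "finite ?F" using assms by (intro finite_PiE) auto
  have sub: "XBox T d \<subseteq> ?h ` ?F"
  proof
    fix m assume m: "m \<in> XBox T d"
    then obtain \<alpha> where \<alpha>: "\<And>i. \<alpha> i \<le> d \<and> m i = Bic (\<alpha> i) 0"
      unfolding XBox_def mem_Collect_eq by metis
    show "m \<in> ?h ` ?F"
    proof (rule image_eqI)
      show "m = ?h (restrict \<alpha> T)"
      proof
        fix i
        show "m i = ?h (restrict \<alpha> T) i"
          using \<alpha>[of i] m by (cases "i \<in> T") (auto simp: XBox_def Mon_def)
      qed
      show "restrict \<alpha> T \<in> ?F" using \<alpha> by auto
    qed
  qed
  then show "finite (XBox T d)" using fin finite_surj by blast
  have "card (XBox T d) \<le> card (?h ` ?F)" using sub fin by (intro card_mono) auto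
  also have "\<dots> \<le> card ?F" using fin by (rule card_image_le)
  also have "\<dots> = (d + 1) ^ card T" using assms by (simp add: card_PiE)
  finally show "card (XBox T d) \<le> (d + 1) ^ card T" .
qed

lemma XBox_0: "0 \<in> XBox T d" by (auto simp: XBox_def zero_bic_def)

lemma XBox_mono: "d \<le> d' \<Longrightarrow> XBox T d \<subseteq> XBox T d'"
  unfolding XBox_def by (auto intro: order_trans)

lemma XBox_add:
  assumes "m \<in> XBox T d" "m' \<in> XBox T d'"
  shows "m + m' \<in> XBox T (d + d')"
proof -
  have "\<exists>a\<le>d + d'. (m + m') i = Bic a 0" for i
  proof -
    obtain a b where "a \<le> d" "m i = Bic a 0" "b \<le> d'" "m' i = Bic b 0"
      using assms unfolding XBox_def by blast
    then show ?thesis by (intro exI[of _ "a + b"]) auto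
  qed
  then show ?thesis using assms Mon_add unfolding XBox_def by blast
qed

lemma keys_mult_XBox:
  assumes "keys a \<subseteq> XBox T d" "keys b \<subseteq> XBox T d'"
  shows "keys (a * b) \<subseteq> XBox T (d + d')"
  using keys_mult[of a b] assms XBox_add by blast

lemma keys_power_XBox:
  assumes "keys (f :: monom \<Rightarrow>\<^sub>0 'k::comm_ring_1) \<subseteq> XBox T d"
  shows "keys (f ^ r) \<subseteq> XBox T (r * d)"
proof (induction r)
  case (Suc r)
  from keys_mult_XBox[OF assms Suc] show ?case by simp
qed (simp add: XBox_0)

lemma exists_XBox:
  assumes "finite T" "finite M" "M \<subseteq> XMon T"
  obtains d where "M \<subseteq> XBox T d"
proof -
  let ?g = "\<lambda>(m, i). case m i of Bic a b \<Rightarrow> a"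
  have "finite (?g ` (M \<times> T))" using assms by auto
  then obtain N where N: "\<forall>x \<in> ?g ` (M \<times> T). x \<le> N"
    using finite_nat_set_iff_bounded_le by blast
  have "M \<subseteq> XBox T N"
  proof
    fix m assume m: "m \<in> M"
    have "\<exists>a\<le>N. m i = Bic a 0" for i
    proof (cases "i \<in> T")
      case True
      obtain a where a: "m i = Bic a 0" using m assms(3) unfolding XMon_def by blast
      have "?g (m, i) \<in> ?g ` (M \<times> T)" using m True by (intro imageI) auto
      with N have "?g (m, i) \<le> N" by blast
      with a show ?thesis by simp
    next
      case False
      then show ?thesis using m assms(3) by (auto simp: XMon_def Mon_def zero_bic_def)
    qed
    then show "m \<in> XBox T N" using m assms(3) by (auto simp: XBox_def XMon_def)
  qed
  with that show ?thesis by blast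
qed

text \<open>The power of the first list member stands leftmost, so that it can be factored out and
  cancelled on the left.\<close>

fun power_prod :: "'a::monoid_mult list \<Rightarrow> nat list \<Rightarrow> 'a" where
  "power_prod (f # fs) (r # rs) = f ^ r * power_prod fs rs"
| "power_prod _ _ = 1"

lemma keys_power_prod:
  fixes fs :: "(monom \<Rightarrow>\<^sub>0 'k::comm_ring_1) list"
  assumes "\<forall>f\<in>set fs. keys f \<subseteq> XBox T d" "set rs \<subseteq> {..N}"
  shows "keys (power_prod fs rs) \<subseteq> XBox T (length fs * (N * d))"
  using assms
proof (induction fs rs rule: power_prod.induct)
  case (1 f fs r rs)
  have "keys (f ^ r) \<subseteq> XBox T (N * d)"
    using keys_power_XBox[of f T d r] XBox_mono[of "r * d" "N * d" T] 1(2,3) by auto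
  moreover have "keys (power_prod fs rs) \<subseteq> XBox T (length fs * (N * d))"
    using 1 by auto
  ultimately have "keys (f ^ r * power_prod fs rs) \<subseteq> XBox T (N * d + length fs * (N * d))"
    by (rule keys_mult_XBox)
  then show ?case by simp
qed (simp_all add: XBox_0)

text \<open>Dimension count: with \<open>L\<close> polynomials and exponents up to \<open>N\<close>
  there are \<open>(N + 1) ^ L\<close> products, but they lie in a space whose dimension grows only
  like \<open>N ^ card T\<close>.\<close>

lemma exists_power_relation:
  fixes fs :: "(monom \<Rightarrow>\<^sub>0 'k::field) list"
  assumes "finite T" "\<forall>f\<in>set fs. keys f \<subseteq> XMon T" "card T < length fs"
  obtains M c where "finite M" "M \<noteq> {}" "\<forall>\<mu>\<in>M. length \<mu> = length fs \<and> c \<mu> \<noteq> 0"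
    "(\<Sum>\<mu>\<in>M. scal (c \<mu>) * power_prod fs \<mu>) = 0"
proof -
  have "finite (\<Union>f\<in>set fs. keys f)" "(\<Union>f\<in>set fs. keys f) \<subseteq> XMon T" using assms by auto
  then obtain d where d: "(\<Union>f\<in>set fs. keys f) \<subseteq> XBox T d"
    using exists_XBox assms(1) by metis
  define L where "L = length fs"
  \<comment> \<open>With this \<open>N\<close> the dimension is at most
    \<open>(N + 1) ^ card T * N\<close>, just below \<open>(N + 1) ^ Suc (card T)\<close>.\<close>
  define N where "N = (L * d + 1) ^ card T"
  define I where "I = {\<mu>. set \<mu> \<subseteq> {..N} \<and> length \<mu> = L}"
  define U where "U = XBox T (L * (N * d))"
  have fin: "finite I" "finite U" unfolding I_def U_def
    using card_XBox[OF assms(1)] by (auto simp: finite_lists_length_eq)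
  have "card U \<le> (L * (N * d) + 1) ^ card T" unfolding U_def by (rule card_XBox[OF assms(1)])
  also have "\<dots> \<le> ((N + 1) * (L * d + 1)) ^ card T"
    by (intro power_mono) (auto simp: algebra_simps)
  also have "\<dots> = (N + 1) ^ card T * N" by (simp only: power_mult_distrib N_def)
  also have "\<dots> < (N + 1) ^ Suc (card T)" by simp
  also have "\<dots> \<le> (N + 1) ^ L" using assms(3) by (intro power_increasing) (auto simp: L_def)
  also have "\<dots> = card I" unfolding I_def by (simp add: card_lists_length_eq)
  finally obtain c where c: "\<exists>\<mu>\<in>I. c \<mu> \<noteq> 0"
    "\<forall>u\<in>U. (\<Sum>\<mu>\<in>I. c \<mu> * lookup (power_prod fs \<mu>) u) = 0"
    using exists_linear_relation[OF fin(2,1), of "\<lambda>\<mu>. lookup (power_prod fs \<mu>)"] by blast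
  have "lookup (\<Sum>\<mu>\<in>I. scal (c \<mu>) * power_prod fs \<mu>) u = 0" for u
  proof (cases "u \<in> U")
    case True
    with c(2) show ?thesis by (simp add: lookup_sum lookup_scal_mult)
  next
    case False
    have "lookup (power_prod fs \<mu>) u = 0" if "\<mu> \<in> I" for \<mu>
    proof -
      have "keys (power_prod fs \<mu>) \<subseteq> U"
        unfolding U_def L_def by (rule keys_power_prod) (use d that in \<open>auto simp: I_def\<close>)
      with False show ?thesis by (auto simp: in_keys_iff)
    qed
    then show ?thesis by (simp add: lookup_sum lookup_scal_mult)
  qed
  then have 0: "(\<Sum>\<mu>\<in>I. scal (c \<mu>) * power_prod fs \<mu>) = 0"
    by (intro poly_mapping_eqI) simp
  show ?thesis
  proof (rule that[of "{\<mu> \<in> I. c \<mu> \<noteq> 0}" c])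
    have "(\<Sum>\<mu>\<in>{\<mu> \<in> I. c \<mu> \<noteq> 0}. scal (c \<mu>) * power_prod fs \<mu>) = (\<Sum>\<mu>\<in>I. scal (c \<mu>) * power_prod fs \<mu>)"
      using fin by (intro sum.mono_neutral_left) auto
    with 0 show "(\<Sum>\<mu>\<in>{\<mu> \<in> I. c \<mu> \<noteq> 0}. scal (c \<mu>) * power_prod fs \<mu>) = 0" by simp
    show "finite {\<mu> \<in> I. c \<mu> \<noteq> 0}" using fin by simp
  qed (use c(1) in \<open>auto simp: I_def L_def\<close>)
qed

text \<open>Each \<open>f\<close> lies in the next prime \<open>P\<close> and is regular modulo some
  \<open>R\<close> below it. Letting \<open>R\<close> be larger than \<open>Q\<close> makes it
  possible to skip primes of a chain. At the end of the list, \<open>Q\<close> must be free of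
  nonzero constants.\<close>

fun flag :: "nat set \<Rightarrow> (monom \<Rightarrow>\<^sub>0 'k::field) set \<Rightarrow> (monom \<Rightarrow>\<^sub>0 'k) list \<Rightarrow> bool" where
  "flag T Q [] \<longleftrightarrow> (\<forall>c. scal c \<in> Q \<longrightarrow> c = 0)"
| "flag T Q (f # fs) \<longleftrightarrow> (\<exists>P. alg_prime T P \<and> (\<exists>R. Q \<subseteq> R \<and> R \<subseteq> P \<and>
      (\<forall>b\<in>alg T. f * b \<in> R \<longrightarrow> b \<in> R)) \<and> f \<in> P \<and> flag T P fs)"

lemma flag_antimono: "flag T Q fs \<Longrightarrow> Q' \<subseteq> Q \<Longrightarrow> flag T Q' fs"
proof (cases fs)
  case (Cons f gs)
  assume "flag T Q fs" "Q' \<subseteq> Q"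
  then show ?thesis unfolding Cons flag.simps by (meson order_trans)
qed (auto simp only: flag.simps)

lemma power_cancel:
  assumes "f \<in> alg T" "\<forall>b\<in>alg T. f * b \<in> R \<longrightarrow> b \<in> R" "b \<in> alg T" "f ^ r * b \<in> R"
  shows "b \<in> R"
  using assms(3,4)
proof (induction r arbitrary: b)
  case (Suc r)
  from Suc.IH[of "f * b"] Suc.prems assms(1,2) show ?case
    by (auto simp: power_Suc2 mult.assoc simp del: power_Suc)
qed simp

lemma alg_power: "f \<in> alg T \<Longrightarrow> f ^ r \<in> alg T"
  by (induction r) auto

lemma alg_power_prod: "set fs \<subseteq> alg T \<Longrightarrow> power_prod fs rs \<in> alg T"
  by (induction fs rs rule: power_prod.induct) (auto intro: alg_power)

lemma alg_sum: "(\<And>i. i \<in> I \<Longrightarrow> f i \<in> alg T) \<Longrightarrow> sum f I \<in> alg T"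
  by (induction I rule: infinite_finite_induct) auto

text \<open>
  The argument of Coquand and Lombardi for the dimension of polynomial rings: in a polynomial
  relation among the members of a flag, the terms with the least exponent of the first member
  can be isolated modulo the next prime.
\<close>

lemma flag_no_relation:
  assumes "flag T Q fs" "set fs \<subseteq> alg T" "finite M" "M \<noteq> {}"
    "\<forall>\<mu>\<in>M. length \<mu> = length fs \<and> c \<mu> \<noteq> 0"
    "(\<Sum>\<mu>\<in>M. scal (c \<mu>) * power_prod fs \<mu>) \<in> Q"
  shows False
  using assms
proof (induction fs arbitrary: Q M c)
  case Nil
  \<comment> \<open>The only exponent vector is the empty one, so the relation puts the nonzero
    constant \<open>c []\<close> into \<open>Q\<close>.\<close>
  then have "M = {[]}" by auto
  then have "(\<Sum>\<mu>\<in>M. scal (c \<mu>) * power_prod [] \<mu>) = scal (c [])"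
    by (simp only: sum.insert sum.empty finite.emptyI empty_iff not_False_eq_True add_0_right power_prod.simps mult_1_right)
  with Nil.prems(5,6) \<open>M = {[]}\<close> have "scal (c []) \<in> Q" "c [] \<noteq> 0" by (simp_all only:) auto
  with Nil.prems(1) show False unfolding flag.simps by blast
next
  case (Cons f fs)
  from Cons.prems(1) obtain P R where PR: "alg_prime T P" "Q \<subseteq> R" "R \<subseteq> P"
    "\<forall>b\<in>alg T. f * b \<in> R \<longrightarrow> b \<in> R" "f \<in> P" "flag T P fs" by auto
  interpret P: alg_prime T P by fact
  have f: "f \<in> alg T" and fs: "set fs \<subseteq> alg T" using Cons.prems(2) by auto
  define r where "r = Min (hd ` M)"
  define M0 where "M0 = {\<mu> \<in> M. hd \<mu> = r}"
  have "r \<in> hd ` M" unfolding r_def using Cons.prems by (intro Min_in) auto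
  then have M0: "M0 \<noteq> {}" "finite M0" "M0 \<subseteq> M" using Cons.prems by (auto simp: M0_def)
  have hd_ge: "r \<le> hd \<mu>" if "\<mu> \<in> M" for \<mu>
    unfolding r_def using Cons.prems that by (intro Min_le) auto
  define t where "t \<mu> = scal (c \<mu>) * (f ^ (hd \<mu> - r) * power_prod fs (tl \<mu>))" for \<mu>
  have t_alg: "t \<mu> \<in> alg T" for \<mu>
    unfolding t_def by (intro alg_mult scal_alg alg_power alg_power_prod f fs)
  have "scal (c \<mu>) * power_prod (f # fs) \<mu> = f ^ r * t \<mu>" if "\<mu> \<in> M" for \<mu>
  proof -
    have "length \<mu> = Suc (length fs)" using Cons.prems(5) that by auto
    then obtain h \<nu> where \<mu>: "\<mu> = h # \<nu>" by (cases \<mu>) auto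
    have "scal (c \<mu>) * power_prod (f # fs) \<mu> = scal (c \<mu>) * f ^ r * (f ^ (h - r) * power_prod fs \<nu>)"
      using hd_ge[OF that] unfolding \<mu> by (simp add: mult.assoc) (simp flip: mult.assoc power_add)
    then show ?thesis unfolding t_def scal_commute[of "c \<mu>" "f ^ r"] by (simp add: \<mu> mult.assoc)
  qed
  then have eq: "(\<Sum>\<mu>\<in>M. scal (c \<mu>) * power_prod (f # fs) \<mu>) = f ^ r * sum t M"
    by (simp add: sum_distrib_left)
  then have "f ^ r * sum t M \<in> R" using Cons.prems(6) PR(2) unfolding eq by blast
  \<comment> \<open>The common factor \<open>f ^ r\<close> is cancelled modulo \<open>R\<close>,
    where \<open>f\<close> is regular, before passing to \<open>P\<close>, which contains
    \<open>f\<close>.\<close>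
  then have "sum t M \<in> R" by (rule power_cancel[OF f PR(4) alg_sum[OF t_alg]])
  then have 1: "sum t M \<in> P" using PR(3) by auto
  \<comment> \<open>Above the least exponent a factor \<open>f\<close> is left over, and
    \<open>f\<close> lies in \<open>P\<close>.\<close>
  have "t \<mu> \<in> P" if "\<mu> \<in> M - M0" for \<mu>
  proof -
    have "hd \<mu> \<noteq> r" "r \<le> hd \<mu>" using that hd_ge[of \<mu>] by (auto simp: M0_def)
    then obtain q where q: "hd \<mu> - r = Suc q" by (cases "hd \<mu> - r") auto
    show ?thesis unfolding t_def q power_Suc
      by (rule P.P_lmult[OF P.P_rmult[OF P.P_rmult]]; intro PR(5) scal_alg alg_power f alg_power_prod fs)
  qed
  then have 2: "sum t (M - M0) \<in> P"
    by (rule P.P_sum)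
  have "sum t M = sum t (M - M0) + sum t M0"
    using M0 Cons.prems(3) by (intro sum.subset_diff) auto
  with P.P_diff[OF 1 2] have 3: "sum t M0 \<in> P" by simp
  have M0_Cons: "\<mu> = r # tl \<mu>" if "\<mu> \<in> M0" for \<mu>
    using that Cons.prems(5) by (cases \<mu>) (auto simp: M0_def)
  \<comment> \<open>All vectors of \<open>M0\<close> start with \<open>r\<close>, so dropping the
    first entry merges no terms and the relation for \<open>fs\<close> keeps its nonzero
    coefficients.\<close>
  have inj: "inj_on tl M0"
  proof (rule inj_onI)
    fix \<mu> \<nu> assume "\<mu> \<in> M0" "\<nu> \<in> M0" and eq: "tl \<mu> = tl \<nu>"
    then show "\<mu> = \<nu>" by (intro trans[OF M0_Cons[of \<mu>, unfolded eq] M0_Cons[of \<nu>, symmetric]])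
  qed
  have "sum t M0 = (\<Sum>\<nu>\<in>tl ` M0. scal (c (r # \<nu>)) * power_prod fs \<nu>)"
    unfolding sum.reindex[OF inj] o_def
  proof (rule sum.cong)
    fix \<mu> assume \<mu>: "\<mu> \<in> M0"
    have "hd \<mu> - r = 0" using \<mu> by (simp add: M0_def)
    then have "t \<mu> = scal (c \<mu>) * power_prod fs (tl \<mu>)"
      unfolding t_def by (simp only: power_0 mult_1_left)
    also have "\<dots> = scal (c (r # tl \<mu>)) * power_prod fs (tl \<mu>)"
      by (rule arg_cong[OF M0_Cons[OF \<mu>], where f = "\<lambda>\<nu>. scal (c \<nu>) * power_prod fs (tl \<mu>)"])
    finally show "t \<mu> = scal (c (r # tl \<mu>)) * power_prod fs (tl \<mu>)" .
  qed simp
  with 3 have 4: "(\<Sum>\<nu>\<in>tl ` M0. scal (c (r # \<nu>)) * power_prod fs \<nu>) \<in> P" by simp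
  have "\<forall>\<nu>\<in>tl ` M0. length \<nu> = length fs \<and> c (r # \<nu>) \<noteq> 0"
  proof
    fix \<nu> assume "\<nu> \<in> tl ` M0"
    then obtain \<mu> where \<mu>: "\<mu> \<in> M0" "\<nu> = tl \<mu>" by blast
    have "r # \<nu> \<in> M" unfolding \<mu>(2) M0_Cons[OF \<mu>(1), symmetric] using \<mu>(1) M0(3) by blast
    then show "length \<nu> = length fs \<and> c (r # \<nu>) \<noteq> 0"
      using Cons.prems(5) by fastforce
  qed
  moreover have "finite (tl ` M0)" "tl ` M0 \<noteq> {}" using M0 by auto
  ultimately show False using Cons.IH[OF PR(6) fs _ _ _ 4] by blast
qed

text \<open>Going down the chain, each step either adds a polynomial to the flag or changes
  \<open>C\<close>. Since \<open>C\<close> has at most \<open>card T\<close> elements, the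
  inequality counts the steps of the first kind; it is written with sums to avoid subtraction of
  natural numbers.\<close>

lemma exists_flag:
  fixes P :: "nat \<Rightarrow> (monom \<Rightarrow>\<^sub>0 'k::field) set"
  assumes "\<forall>i\<le>s. alg_prime T (P i)" "\<forall>i<s. P i \<subset> P (Suc i)"
  shows "\<exists>fs. flag T (P 0) fs \<and> (\<forall>f\<in>set fs. keys f \<subseteq> XMon T) \<and>
    s + card (alg_prime.C T (P 0)) \<le> length fs + card T"
  using assms
proof (induction s arbitrary: P)
  case 0
  interpret alg_prime T "P 0" using 0 by auto
  have "c = 0" if "scal c \<in> P 0" for c
  proof (rule ccontr)
    assume "c \<noteq> 0"
    with P_rmult[OF that scal_alg, of "inverse c"] one_notin_P show False
      by (simp add: mult_single)
  qed
  then show ?case using card_mono[OF finite_T C_sub] by (intro exI[of _ "[]"]) auto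
next
  case (Suc s)
  from Suc.IH[of "\<lambda>i. P (Suc i)"] Suc.prems obtain fs where
    fs: "flag T (P 1) fs" "\<forall>f\<in>set fs. keys f \<subseteq> XMon T"
      "s + card (alg_prime.C T (P 1)) \<le> length fs + card T" by auto
  have P: "alg_prime T (P 0)" "alg_prime T (P 1)" "P 0 \<subset> P 1" using Suc.prems by auto
  interpret P0: alg_prime T "P 0" by fact
  interpret P1: alg_prime T "P 1" by fact
  show ?case
  proof (cases "P0.C = P1.C")
    case True
    obtain f where f: "keys f \<subseteq> XMon T" "f \<in> P 1" "\<And>b. b \<in> alg T \<Longrightarrow> f * b \<in> P 0 \<Longrightarrow> b \<in> P 0"
      using exists_poly_between[OF P True] by blast
    have "flag T (P 0) (f # fs)"
      unfolding flag.simps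
      by (intro exI[of _ "P 1"] exI[of _ "P 0"] conjI ballI impI) (use f fs(1) P in auto)
    then show ?thesis using f(1) fs(2,3) True by (intro exI[of _ "f # fs"]) auto
  next
    case False
    moreover have "P0.C \<subseteq> P1.C" unfolding P0.C_def P1.C_def using P(3) by blast
    ultimately have "P0.C \<subset> P1.C" by blast
    then have "card P0.C < card P1.C"
      using finite_subset[OF P1.C_sub P1.finite_T] by (intro psubset_card_mono)
    \<comment> \<open>The flag for \<open>P 1\<close> also serves for the smaller
      \<open>P 0\<close>; the growth of \<open>C\<close> accounts for this step in the
      count.\<close>
    with fs flag_antimono[OF fs(1)] P(3) show ?thesis by (intro exI[of _ fs]) auto
  qed
qed

text \<open>A longer chain would give a flag of more than \<open>card T\<close> polynomials. They
  are algebraically dependent, and the value 0 of the relation lies in \<open>P 0\<close>.\<close>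

theorem alg_prime_chain_length:
  fixes P :: "nat \<Rightarrow> (monom \<Rightarrow>\<^sub>0 'k::field) set"
  assumes "\<forall>i\<le>s. alg_prime T (P i)" "\<forall>i<s. P i \<subset> P (Suc i)"
  shows "s \<le> 2 * card T"
proof (rule ccontr)
  assume "\<not> s \<le> 2 * card T"
  interpret P: alg_prime T "P 0" using assms by auto
  obtain fs where fs: "flag T (P 0) fs" "\<forall>f\<in>set fs. keys f \<subseteq> XMon T"
    "s + card P.C \<le> length fs + card T"
    using exists_flag[OF assms] by blast
  then have "card T < length fs" using \<open>\<not> s \<le> 2 * card T\<close> by simp
  then obtain M c where M: "finite M" "M \<noteq> {}" "\<forall>\<mu>\<in>M. length \<mu> = length fs \<and> c \<mu> \<noteq> 0"
    "(\<Sum>\<mu>\<in>M. scal (c \<mu>) * power_prod fs \<mu>) = 0"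
    using exists_power_relation[OF P.finite_T fs(2)] by blast
  have "set fs \<subseteq> alg T" using fs(2) by (auto simp: alg_def XMon_def)
  from flag_no_relation[OF fs(1) this M(1-3)] M(4) P.P_0 show False by simp
qed

section \<open>A chain of primes of length 2n\<close>

text \<open>Serves three maps: the projections to quotient monoid algebras, the evaluation of words,
  and the assignment of normal forms. Only the first two are multiplicative.\<close>

locale additive_ext =
  fixes F :: "'m \<Rightarrow> 'c::ab_group_add \<Rightarrow> 'r::ab_group_add"
  assumes F_add: "F m (c + d) = F m c + F m d"
begin

lemma F_0 [simp]: "F m 0 = 0"
  using F_add[of m 0 0] by simp

definition lin :: "('m \<Rightarrow>\<^sub>0 'c) \<Rightarrow> 'r" where "lin a = (\<Sum>m\<in>keys a. F m (lookup a m))"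

lemma lin_superset: "finite M \<Longrightarrow> keys a \<subseteq> M \<Longrightarrow> lin a = (\<Sum>m\<in>M. F m (lookup a m))"
  unfolding lin_def by (intro sum.mono_neutral_left) (auto simp: in_keys_iff)

lemma lin_0 [simp]: "lin 0 = 0" by (simp add: lin_def)

lemma lin_single [simp]: "lin (single m c) = F m c"
  by (subst lin_superset[of "{m}"]) auto

lemma lin_add: "lin (a + b) = lin a + lin b"
proof -
  have "keys (a + b) \<subseteq> keys a \<union> keys b" by (rule keys_add)
  then show ?thesis
    by (subst (1 2 3) lin_superset[of "keys a \<union> keys b"]) (auto simp: lookup_add F_add sum.distrib)
qed

lemma lin_uminus: "lin (- a) = - lin a"
  using lin_add[of a "- a"] by (simp add: eq_neg_iff_add_eq_0 add.commute)

lemma lin_diff: "lin (a - b) = lin a - lin b"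
  using lin_add[of a "- b"] by (simp add: lin_uminus)

end

locale ring_ext = additive_ext F
  for F :: "'m::monoid_add \<Rightarrow> 'c::ring_1 \<Rightarrow> 'r::ring_1" +
  assumes F_mult: "F (m + m') (c * d) = F m c * F m' d"
    and F_one: "F 0 1 = 1"
begin

lemma lin_one [simp]: "lin 1 = 1"
  using lin_single[of 0 1] by (simp add: F_one)

lemma lin_mult: "lin (a * b) = lin a * lin b"
proof -
  have "keys a \<subseteq> UNIV" by simp
  then show ?thesis
  proof (induction rule: keys_induct)
    case (single m c)
    have "keys b \<subseteq> UNIV" by simp
    then show ?case
      by (induction rule: keys_induct) (simp_all add: mult_single F_mult lin_add distrib_left)
  qed (simp_all add: lin_add distrib_right)
qed

end

section \<open>Quotients of the monoid algebra and primeness of their kernels\<close>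

definition restr :: "nat set \<Rightarrow> monom \<Rightarrow> monom" where
  "restr S m = (\<lambda>i. if i \<in> S then m i else 0)"

lemma restr_add: "restr S (m + m') = restr S m + restr S m'"
  by (auto simp: restr_def fun_eq_iff)

lemma restr_0 [simp]: "restr S 0 = 0"
  by (auto simp: restr_def fun_eq_iff)

lemma restr_Mon: "m \<in> Mon T \<Longrightarrow> restr S m \<in> Mon (S \<inter> T)"
  by (auto simp: restr_def Mon_def)

lemma restr_id: "m \<in> Mon S \<Longrightarrow> restr S m = m"
  by (auto simp: restr_def Mon_def)

text \<open>Take a key \<open>m0\<close> of least total exponent, with coordinates x^a y^b, and
  multiply by y^a on the left and x^b on the right. This sends \<open>m0\<close> to 1, and any other
  monomial sent to 1 has coordinates x^(a-k) y^(b-k), hence smaller total exponent. So nothing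
  cancels the coefficient of \<open>m0\<close>.\<close>

lemma exists_lookup_0_nonzero:
  fixes p :: "monom \<Rightarrow>\<^sub>0 'd::comm_ring_1"
  assumes "finite S" "p \<in> alg S" "p \<noteq> 0"
  obtains x y where "x \<in> Mon S" "y \<in> Mon S" "lookup (mon x * p * mon y) 0 \<noteq> 0"
proof -
  define size :: "bic \<Rightarrow> nat" where "size q = (case q of Bic a b \<Rightarrow> a + b)" for q
  define wt where "wt m = (\<Sum>i\<in>S. size (m i))" for m
  have "keys p \<noteq> {}" using assms(3) by (auto simp: poly_mapping_eq_iff in_keys_iff fun_eq_iff)
  then obtain m0 where m0: "m0 \<in> keys p" "\<And>m. m \<in> keys p \<Longrightarrow> wt m0 \<le> wt m"
    using ex_min_if_finite[of "wt ` keys p"] by (auto simp: not_less)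
  define x y where "x = (\<lambda>i. case m0 i of Bic a b \<Rightarrow> Bic 0 a)" and "y = (\<lambda>i. case m0 i of Bic a b \<Rightarrow> Bic b 0)"
  have m0S: "m0 \<in> Mon S" using m0(1) assms(2) by (auto simp: alg_def)
  have unique: "m = m0" if m: "m \<in> keys p" "x + m + y = 0" for m
  proof -
    have *: "m i = m0 i \<or> size (m i) < size (m0 i)" for i
    proof -
      have "x i + m i + y i = 0" using fun_cong[OF m(2), of i] by simp
      then show ?thesis
        by (cases "m i"; cases "m0 i") (auto simp: x_def y_def zero_bic_def size_def)
    qed
    have "m i = m0 i" for i
    proof (cases "i \<in> S")
      case True
      show ?thesis
      proof (rule ccontr)
        assume "m i \<noteq> m0 i"
        with * have "size (m i) < size (m0 i)" by auto
        then have "wt m < wt m0" unfolding wt_def using True *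
          by (intro sum_strict_mono_ex1[OF assms(1)]) (auto simp: less_imp_le, metis less_imp_le order_refl)
        with m0(2)[OF m(1)] show False by simp
      qed
    next
      case False
      have "m \<in> Mon S" using m(1) assms(2) by (auto simp: alg_def)
      with False m0S show ?thesis by (auto simp: Mon_def)
    qed
    then show ?thesis by auto
  qed
  have eq0: "x + m0 + y = 0"
  proof
    fix i show "(x + m0 + y) i = 0 i"
      by (cases "m0 i") (auto simp: x_def y_def zero_bic_def)
  qed
  have "mon x * p * mon y = (\<Sum>m\<in>keys p. single (x + m + y) (lookup p m))"
    by (subst poly_mapping_sum_singles[of p]) (simp add: sum_distrib_left sum_distrib_right mult_single)
  then have "lookup (mon x * p * mon y) 0 = (\<Sum>m\<in>keys p. lookup (single (x + m + y) (lookup p m)) 0)"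
    by (simp add: lookup_sum)
  also have "\<dots> = (\<Sum>m\<in>keys p. if m = m0 then lookup p m0 else 0)"
  proof (rule sum.cong)
    fix m assume "m \<in> keys p"
    show "lookup (single (x + m + y) (lookup p m)) 0 = (if m = m0 then lookup p m0 else 0)"
    proof (cases "m = m0")
      case True
      then show ?thesis by (simp only: eq0 lookup_single_eq if_True simp_thms)
    next
      case False
      with unique \<open>m \<in> keys p\<close> have "x + m + y \<noteq> 0" by blast
      with False show ?thesis by (simp only: lookup_single_not_eq if_False simp_thms)
    qed
  qed simp
  also have "\<dots> = lookup p m0" using m0(1) by simp
  finally have "lookup (mon x * p * mon y) 0 \<noteq> 0" using m0(1) by (simp only: in_keys_iff) simp
  moreover have "x \<in> Mon S" "y \<in> Mon S" using m0S by (auto simp: x_def y_def Mon_def zero_bic_def)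
  ultimately show ?thesis using that by blast
qed

text \<open>All monomials in the coordinates \<open>js\<close> except 1 die between the two copies
  of the idempotent, so only the constant coefficient survives.\<close>

lemma idemps_sandwich_scalar:
  fixes p :: "monom \<Rightarrow>\<^sub>0 'd::comm_ring_1"
  assumes "p \<in> alg (set js)"
  shows "idemps js * p * idemps js = scal (lookup p 0) * idemps js"
  using assms
proof (induction rule: alg_induct)
  case (single m c)
  show ?case
  proof (cases "m = 0")
    case True
    have "idemps js * scal c * idemps js = scal c * (idemps js :: monom \<Rightarrow>\<^sub>0 'd)"
      by (rule idemps_single_idemps[of _ "{}"]) auto
    then show ?thesis unfolding True lookup_single_eq .
  next
    case False
    then obtain j where j: "m j \<noteq> 0" by (auto simp: fun_eq_iff)
    with single have "j \<in> set js" by (auto simp: Mon_def)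
    from idemps_single_idemps_eq_0[OF this, of m, OF j] False show ?thesis
      by (simp only: lookup_single_not_eq single_zero mult_zero_left not_False_eq_True)
  qed
qed (simp_all add: algebra_simps lookup_add single_add)

text \<open>Coordinates in \<open>S\<close> are kept; what remains visible of the others is the
  integer \<open>\<chi> m\<close>, recorded as the exponent of a Laurent variable in the
  coefficients. One variable is enough because the chain treats the coordinates one at a
  time.\<close>

locale monomial_quotient =
  fixes S :: "nat set" and \<chi> :: "monom \<Rightarrow> int"
  assumes chi_add: "\<chi> (m + m') = \<chi> m + \<chi> m'"
    and chi_Mon: "m \<in> Mon S \<Longrightarrow> \<chi> m = 0"
begin

definition coef :: "monom \<Rightarrow> 'k::field \<Rightarrow> (monom \<Rightarrow>\<^sub>0 (int \<Rightarrow>\<^sub>0 'k))" where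
  "coef m c = single (restr S m) (single (\<chi> m) c)"

sublocale ring_ext coef
  by standard (simp_all add: coef_def single_add restr_add chi_add mult_single chi_Mon)

lemma lookup_lin:
  "lookup (lookup (lin a) u) z = (\<Sum>m | m \<in> keys a \<and> (restr S m, \<chi> m) = (u, z). lookup a m)"
proof -
  have "lookup (lookup (lin a) u) z = (\<Sum>m\<in>keys a. if (restr S m, \<chi> m) = (u, z) then lookup a m else 0)"
    unfolding lin_def lookup_sum coef_def
    by (intro sum.cong) (auto simp: lookup_single when_def)
  then show ?thesis by (simp add: sum.inter_filter)
qed

lemma lin_mon:
  assumes "m \<in> Mon S"
  shows "lin (mon m :: monom \<Rightarrow>\<^sub>0 'k::field) = mon m"
  using assms by (simp add: coef_def restr_id chi_Mon)

lemma lin_idemp: "i \<in> S \<Longrightarrow> lin (idemp i :: monom \<Rightarrow>\<^sub>0 'k::field) = idemp i"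
  unfolding idemp_def lin_diff lin_one by (simp only: lin_mon loc_Mon)

lemma lin_idemps: "set js \<subseteq> S \<Longrightarrow> lin (idemps js :: monom \<Rightarrow>\<^sub>0 'k::field) = idemps js"
  by (induction js) (simp_all add: lin_mult lin_idemp)

lemma lin_alg:
  assumes "a \<in> alg T"
  shows "lin (a :: monom \<Rightarrow>\<^sub>0 'k::field) \<in> alg (S \<inter> T)"
  unfolding lin_def coef_def
  by (intro alg_sum alg_single restr_Mon) (use assms in \<open>auto simp: alg_def\<close>)

definition ker :: "nat set \<Rightarrow> (monom \<Rightarrow>\<^sub>0 'k::field) set" where
  "ker T = {a \<in> alg T. lin a = 0}"

text \<open>Two elements outside the kernel can be multiplied by monomials until their images have
  nonzero constant coefficients. Sandwiching these images between copies of \<open>E\<close> gives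
  the product of the two coefficients times \<open>E\<close>, which is not zero.\<close>

lemma alg_prime_ker:
  assumes "finite T"
  shows "alg_prime T (ker T :: (monom \<Rightarrow>\<^sub>0 'k::field) set)"
proof
  fix a b :: "monom \<Rightarrow>\<^sub>0 'k"
  assume ab: "a \<in> alg T" "b \<in> alg T" and prime: "\<And>s. s \<in> alg T \<Longrightarrow> a * s * b \<in> ker T"
  show "a \<in> ker T \<or> b \<in> ker T"
  proof (rule ccontr)
    assume "\<not> (a \<in> ker T \<or> b \<in> ker T)"
    then have nz: "lin a \<noteq> 0" "lin b \<noteq> 0" using ab by (auto simp: ker_def)
    have fin: "finite (S \<inter> T)" using assms by auto
    define js where "js = sorted_list_of_set (S \<inter> T)"
    have js: "set js = S \<inter> T" unfolding js_def using fin by simp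
    note la = lin_alg[OF ab(1)] and lb = lin_alg[OF ab(2)]
    obtain x1 y1 where 1: "x1 \<in> Mon (S \<inter> T)" "y1 \<in> Mon (S \<inter> T)" "lookup (mon x1 * lin a * mon y1) 0 \<noteq> 0"
      using exists_lookup_0_nonzero[OF fin la nz(1)] .
    obtain x2 y2 where 2: "x2 \<in> Mon (S \<inter> T)" "y2 \<in> Mon (S \<inter> T)" "lookup (mon x2 * lin b * mon y2) 0 \<noteq> 0"
      using exists_lookup_0_nonzero[OF fin lb nz(2)] .
    define p q where "p = mon x1 * lin a * mon y1" and "q = mon x2 * lin b * mon y2"
    define E :: "monom \<Rightarrow>\<^sub>0 (int \<Rightarrow>\<^sub>0 'k)" where "E = idemps js"
    have pq: "p \<in> alg (set js)" "q \<in> alg (set js)"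
      unfolding p_def q_def js by (intro alg_mult alg_single la lb 1 2)+
    \<comment> \<open>The middle factor to which the hypothesis is applied: after projection it
      joins \<open>p\<close> and \<open>q\<close> through \<open>E\<close>.\<close>
    have "mon y1 * idemps js * mon x2 \<in> (alg T :: (monom \<Rightarrow>\<^sub>0 'k) set)"
      using js 1 2 by (intro alg_mult idemps_alg alg_single) (auto intro: Mon_mono[rotated])
    from prime[OF this] have "lin a * (mon y1 * E * mon x2) * lin b = 0"
      using js 1 2 by (simp add: ker_def lin_mult lin_idemps E_def lin_mon Mon_mono[of "S \<inter> T" S] del: lin_single)
    then have "E * mon x1 * (lin a * (mon y1 * E * mon x2) * lin b) * mon y2 * E = 0"
      by simp
    then have "(E * p * E) * q * E = 0" unfolding p_def q_def by (simp only: mult.assoc)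
    also have "E * p * E = scal (lookup p 0) * E"
      unfolding E_def by (rule idemps_sandwich_scalar[OF pq(1)])
    also have "scal (lookup p 0) * E * q * E = scal (lookup p 0) * (E * q * E)"
      by (simp only: mult.assoc)
    also have "E * q * E = scal (lookup q 0) * E"
      unfolding E_def by (rule idemps_sandwich_scalar[OF pq(2)])
    finally have "lookup (scal (lookup p 0) * (scal (lookup q 0) * E)) 0 = 0"
      by (simp only: lookup_zero)
    \<comment> \<open>The constant coefficient of \<open>E\<close> is 1. The resulting equation is
      impossible because Laurent polynomials over a field have no zero divisors.\<close>
    then have "lookup p 0 * lookup q 0 = 0"
      unfolding lookup_scal_mult E_def lookup_idemps_0 by (simp only: mult_1_right)
    with 1(3) 2(3) show False unfolding p_def q_def by simp
  qed
qed (auto simp: ker_def assms lin_add lin_mult)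

text \<open>Membership depends only on the fibres of the monomial map, so coarser maps have larger
  kernels.\<close>

lemma mem_ker_iff:
  "a \<in> ker T \<longleftrightarrow> a \<in> alg T \<and> (\<forall>g. (\<Sum>m | m \<in> keys a \<and> (restr S m, \<chi> m) = g. lookup a m) = 0)"
proof -
  have "lin a = 0 \<longleftrightarrow> (\<forall>u z. lookup (lookup (lin a) u) z = 0)"
    by (auto simp: poly_mapping_eq_iff fun_eq_iff)
  then show ?thesis unfolding ker_def lookup_lin by auto
qed

end

section \<open>The explicit chain of kernels\<close>

lemma fibre_sums_coarsen:
  assumes "finite M" "\<forall>g. (\<Sum>m | m \<in> M \<and> h m = g. f m) = 0"
  shows "(\<Sum>m | m \<in> M \<and> G (h m) = v. f m) = (0 :: 'a::comm_monoid_add)"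
proof -
  let ?S = "{m \<in> M. G (h m) = v}"
  have "sum f ?S = (\<Sum>g\<in>h ` ?S. sum f {m \<in> ?S. h m = g})"
    using assms(1) by (intro sum.group[symmetric]) auto
  also have "\<dots> = (\<Sum>g\<in>h ` ?S. sum f {m \<in> M. h m = g})"
    by (intro sum.cong refl arg_cong2[where f = sum]) auto
  also have "\<dots> = 0" using assms(2) by simp
  finally show ?thesis .
qed

text \<open>For k = 2 j the coordinates 1 to j are forgotten. For k = 2 j + 1, in addition,
  coordinate j + 1 is seen only through its degree; this is why the bound is k / 2 rounded
  up.\<close>

definition chain_set :: "nat \<Rightarrow> nat set" where "chain_set k = {i. i > (k + 1) div 2}"

definition chain_deg :: "nat \<Rightarrow> monom \<Rightarrow> int" where
  "chain_deg k m = (if odd k then deg (m ((k + 1) div 2)) else 0)"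

interpretation mq: monomial_quotient "chain_set k" "chain_deg k" for k
  by standard (auto simp: chain_set_def chain_deg_def deg_add Mon_def)

lemma mq_ker_Suc: "mq.ker k T \<subseteq> (mq.ker (Suc k) T :: (monom \<Rightarrow>\<^sub>0 'k::field) set)"
proof
  fix a :: "monom \<Rightarrow>\<^sub>0 'k" assume a: "a \<in> mq.ker k T"
  \<comment> \<open>The monomial map of step \<open>Suc k\<close> factors through that of step
    \<open>k\<close>: for even \<open>k\<close> the next coordinate is reduced to its degree, for
    odd \<open>k\<close> the degree is dropped.\<close>
  define G where "G = (\<lambda>(u :: monom, z :: int).
    if even k then (restr (chain_set (Suc k)) u, deg (u (Suc (k div 2)))) else (u, 0))"
  have G: "(restr (chain_set (Suc k)) m, chain_deg (Suc k) m) = G (restr (chain_set k) m, chain_deg k m)" for m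
  proof (cases "even k")
    case True
    then obtain j where k: "k = 2 * j" by (elim evenE)
    show ?thesis by (simp add: G_def chain_set_def chain_deg_def restr_def k fun_eq_iff)
  next
    case False
    then obtain j where k: "k = 2 * j + 1" by (elim oddE)
    show ?thesis by (simp add: G_def chain_set_def chain_deg_def restr_def k)
  qed
  show "a \<in> mq.ker (Suc k) T"
    unfolding mq.mem_ker_iff
  proof (intro conjI allI)
    show "a \<in> alg T" using a unfolding mq.mem_ker_iff by (rule conjunct1)
    have *: "\<forall>g. (\<Sum>m | m \<in> keys a \<and> (restr (chain_set k) m, chain_deg k m) = g. lookup a m) = 0"
      using a unfolding mq.mem_ker_iff by (rule conjunct2)
    show "(\<Sum>m | m \<in> keys a \<and> (restr (chain_set (Suc k)) m, chain_deg (Suc k) m) = g. lookup a m) = 0" for g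
      unfolding G by (rule fibre_sums_coarsen[OF finite_keys *])
  qed
qed

lemma mq_ker_strict:
  assumes "k < 2 * n"
  shows "mq.ker k {1..n} \<subset> (mq.ker (Suc k) {1..n} :: (monom \<Rightarrow>\<^sub>0 'k::field) set)"
proof -
  have "\<exists>a \<in> mq.ker (Suc k) {1..n}. (a :: monom \<Rightarrow>\<^sub>0 'k) \<notin> mq.ker k {1..n}"
  proof (cases "even k")
    case True
    then obtain j where k: "k = 2 * j" by (elim evenE)
    \<comment> \<open>Reducing coordinate j + 1 to its degree identifies x y with 1.\<close>
    let ?a = "idemp (Suc j) :: monom \<Rightarrow>\<^sub>0 'k"
    have "mq.lin k ?a = idemp (Suc j)" by (rule mq.lin_idemp) (simp add: chain_set_def k)
    moreover have "lookup (idemp (Suc j) :: monom \<Rightarrow>\<^sub>0 (int \<Rightarrow>\<^sub>0 'k)) 0 = 1"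
      using lookup_idemps_0[of "[Suc j]"] by simp
    ultimately have "mq.lin k ?a \<noteq> 0" by force
    moreover have "restr (chain_set (Suc k)) (loc (Suc j) (Bic 1 1)) = 0"
      by (auto simp: restr_def loc_def chain_set_def k fun_eq_iff)
    then have "mq.lin (Suc k) ?a = 0"
      unfolding idemp_def mq.lin_diff mq.lin_one mq.lin_single mq.coef_def
      by (simp add: chain_deg_def k loc_def)
    moreover have "?a \<in> alg {1..n}" using assms k by (intro idemp_alg) auto
    ultimately show ?thesis unfolding mq.ker_def by blast
  next
    case False
    then obtain j where k: "k = 2 * j + 1" by (elim oddE)
    \<comment> \<open>Forgetting the degree of coordinate j + 1 identifies x with 1, while the
      degree still separates them one step earlier.\<close>
    let ?m = "loc (Suc j) (Bic 1 0)"
    let ?a = "mon ?m - 1 :: monom \<Rightarrow>\<^sub>0 'k"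
    have r: "restr (chain_set k) ?m = 0" "restr (chain_set (Suc k)) ?m = 0"
      by (auto simp: restr_def loc_def chain_set_def k fun_eq_iff)
    have d: "chain_deg k ?m = 1" "chain_deg (Suc k) ?m = 0"
      by (auto simp: chain_deg_def k loc_def)
    have "mq.lin k ?a = single 0 (single 1 1) - 1"
      unfolding mq.lin_diff mq.lin_one mq.lin_single mq.coef_def r d ..
    moreover have "lookup (lookup (single 0 (single 1 1) - 1 :: monom \<Rightarrow>\<^sub>0 (int \<Rightarrow>\<^sub>0 'k)) 0) 1 = 1"
      by (simp add: lookup_minus lookup_one)
    ultimately have "mq.lin k ?a \<noteq> 0" by force
    moreover have "mq.lin (Suc k) ?a = 0"
      unfolding mq.lin_diff mq.lin_one mq.lin_single mq.coef_def r d by simp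
    moreover have "?a \<in> alg {1..n}" using assms k by (intro alg_diff alg_1 alg_single loc_Mon) auto
    ultimately show ?thesis unfolding mq.ker_def by blast
  qed
  with mq_ker_Suc show ?thesis by blast
qed

lemma exists_alg_prime_chain:
  "\<exists>P :: nat \<Rightarrow> (monom \<Rightarrow>\<^sub>0 'k::field) set.
    (\<forall>i\<le>2 * n. alg_prime {1..n} (P i)) \<and> (\<forall>i<2 * n. P i \<subset> P (Suc i))"
  by (intro exI[of _ "\<lambda>k. mq.ker k {1..n}"] conjI allI impI mq.alg_prime_ker mq_ker_strict) auto

section \<open>Ideals of rings with carrier\<close>

lemma nc_prime_ideal_vimage_iso:
  assumes "ring R" "ring S" "h \<in> ring_iso R S" "nc_prime_ideal P S"
  shows "nc_prime_ideal {r \<in> carrier R. h r \<in> P} R"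
proof -
  interpret R: ring R by fact
  interpret S: ring S by fact
  define g where "g = inv_into (carrier R) h"
  have h: "h \<in> ring_hom R S" "bij_betw h (carrier R) (carrier S)"
    using assms(3) by (auto simp: ring_iso_def)
  have g: "g \<in> ring_iso S R" unfolding g_def by (rule ring_iso_set_sym[OF assms(1,3)])
  interpret h: ring_hom_ring R S h using h(1) by (rule ring_hom_ringI2[OF assms(1,2)])
  interpret g: ring_hom_ring S R g using g by (intro ring_hom_ringI2 assms) (simp add: ring_iso_def)
  have hg: "h (g s) = s" if "s \<in> carrier S" for s
    using that h(2) unfolding g_def by (auto simp: bij_betw_def f_inv_into_f)
  have gh: "g (h r) = r" if "r \<in> carrier R" for r
    using that h(2) unfolding g_def by (auto simp: bij_betw_def inv_into_f_f)
  have P: "ideal P S" "P \<noteq> carrier S"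
    and prime: "\<And>I J. ideal I S \<Longrightarrow> ideal J S \<Longrightarrow> ideal_prod S I J \<subseteq> P \<Longrightarrow> I \<subseteq> P \<or> J \<subseteq> P"
    using assms(4) by (auto simp: nc_prime_ideal_def)
  interpret P: ideal P S by fact
  let ?Q = "{r \<in> carrier R. h r \<in> P}"
  have "?Q \<noteq> carrier R"
  proof
    assume "?Q = carrier R"
    then have "h (g s) \<in> P" if "s \<in> carrier S" for s using that g.hom_closed by blast
    then have "carrier S \<subseteq> P" using hg by auto
    with P.a_subset P(2) show False by blast
  qed
  moreover have "I \<subseteq> ?Q \<or> J \<subseteq> ?Q" if I: "ideal I R" and J: "ideal J R" and IJ: "ideal_prod R I J \<subseteq> ?Q" for I J
  proof -
    interpret I: ideal I R by fact
    interpret J: ideal J R by fact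
    \<comment> \<open>Ideals of \<open>R\<close> are moved to \<open>S\<close> as preimages under
      the inverse \<open>g\<close>, where the primeness of \<open>P\<close> can be used.\<close>
    define I' J' where "I' = {s \<in> carrier S. g s \<in> I}" and "J' = {s \<in> carrier S. g s \<in> J}"
    have I'J': "ideal I' S" "ideal J' S" unfolding I'_def J'_def
      by (rule g.ideal_vimage[OF I], rule g.ideal_vimage[OF J])
    have "x \<in> P" if "x \<in> ideal_prod S I' J'" for x
      using that
    proof (induction rule: ideal_prod.induct)
      case (prod i j)
      then have ij: "i \<in> carrier S" "j \<in> carrier S" "g i \<in> I" "g j \<in> J" by (auto simp: I'_def J'_def)
      from subsetD[OF IJ ideal_prod.prod[OF ij(3,4)]]
      have "h (g i \<otimes>\<^bsub>R\<^esub> g j) \<in> P" by blast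
      with ij show ?case by (simp add: hg)
    qed simp
    then have "I' \<subseteq> P \<or> J' \<subseteq> P" using prime[OF I'J'] by blast
    moreover have "I \<subseteq> ?Q" if "I' \<subseteq> P"
    proof
      fix r assume r: "r \<in> I"
      then have "r \<in> carrier R" using I.a_subset by blast
      with r have "h r \<in> I'" by (simp add: I'_def gh)
      with that \<open>r \<in> carrier R\<close> show "r \<in> ?Q" by auto
    qed
    moreover have "J \<subseteq> ?Q" if "J' \<subseteq> P"
    proof
      fix r assume r: "r \<in> J"
      then have "r \<in> carrier R" using J.a_subset by blast
      with r have "h r \<in> J'" by (simp add: J'_def gh)
      with that \<open>r \<in> carrier R\<close> show "r \<in> ?Q" by auto
    qed
    ultimately show ?thesis by blast
  qed
  ultimately show ?thesis
    unfolding nc_prime_ideal_def using h.ideal_vimage[OF P(1)] by blast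
qed

lemma classical_krull_dim_iso_le:
  fixes R :: "('a, 'm) ring_scheme" and S :: "('b, 'n) ring_scheme"
  assumes "ring R" "ring S" "h \<in> ring_iso R S"
  shows "classical_krull_dim S \<le> classical_krull_dim R"
  unfolding classical_krull_dim_def
proof (rule Sup_subset_mono, clarify)
  fix s and P :: "nat \<Rightarrow> 'b set"
  assume P: "\<forall>i\<le>s. nc_prime_ideal (P i) S" "\<forall>i<s. P i \<subset> P (Suc i)"
  let ?Q = "\<lambda>i. {r \<in> carrier R. h r \<in> P i}"
  have "?Q i \<subset> ?Q (Suc i)" if i: "i < s" for i
  proof -
    obtain x where x: "x \<in> P (Suc i)" "x \<notin> P i" using P(2) i by blast
    have "ideal (P (Suc i)) S" using P(1) i by (auto simp: nc_prime_ideal_def)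
    then have "x \<in> carrier S" using x(1) ideal.Icarr by metis
    moreover have "h ` carrier R = carrier S" using assms(3) by (auto simp: ring_iso_def bij_betw_def)
    ultimately have "x \<in> h ` carrier R" by simp
    then obtain r where r: "r \<in> carrier R" "h r = x" by (elim imageE) simp
    have "P i \<subset> P (Suc i)" using P(2) i by blast
    with x r show ?thesis by auto
  qed
  moreover have "nc_prime_ideal (?Q i) R" if "i \<le> s" for i
    using nc_prime_ideal_vimage_iso[OF assms] P(1) that by blast
  ultimately show "\<exists>s'. enat s = enat s' \<and>
      (\<exists>P. (\<forall>i\<le>s'. nc_prime_ideal (P i) R) \<and> (\<forall>i<s'. P i \<subset> P (Suc i)))"
    by (intro exI[of _ s] conjI refl exI[of _ ?Q]) auto
qed

lemma classical_krull_dim_iso: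
  assumes "ring R" "ring S" "h \<in> ring_iso R S"
  shows "classical_krull_dim R = classical_krull_dim S"
  using classical_krull_dim_iso_le[OF assms]
    classical_krull_dim_iso_le[OF assms(2,1) ring_iso_set_sym[OF assms(1,3)]]
  by (rule antisym[rotated])

section \<open>The monoid algebra as a ring with carrier\<close>

definition alg_ring :: "nat set \<Rightarrow> (monom \<Rightarrow>\<^sub>0 'k::field) ring" where
  "alg_ring T = \<lparr>carrier = alg T, mult = (*), one = 1, zero = 0, add = (+)\<rparr>"

lemma alg_ring_simps [simp]:
  "carrier (alg_ring T) = alg T" "mult (alg_ring T) = (*)" "one (alg_ring T) = 1"
  "zero (alg_ring T) = 0" "add (alg_ring T) = (+)"
  by (simp_all add: alg_ring_def)

lemma ring_alg_ring: "ring (alg_ring T :: (monom \<Rightarrow>\<^sub>0 'k::field) ring)"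
proof (intro ringI abelian_groupI monoidI)
  fix x :: "monom \<Rightarrow>\<^sub>0 'k"
  assume "x \<in> carrier (alg_ring T)"
  then show "\<exists>y\<in>carrier (alg_ring T). y \<oplus>\<^bsub>alg_ring T\<^esub> x = \<zero>\<^bsub>alg_ring T\<^esub>"
    by (intro bexI[of _ "- x"]) auto
qed (auto simp: algebra_simps)

lemma ideal_alg_ring_iff:
  "ideal I (alg_ring T :: (monom \<Rightarrow>\<^sub>0 'k::field) ring) \<longleftrightarrow>
    I \<subseteq> alg T \<and> 0 \<in> I \<and> (\<forall>a\<in>I. \<forall>b\<in>I. a + b \<in> I) \<and> (\<forall>a\<in>I. \<forall>s\<in>alg T. s * a \<in> I \<and> a * s \<in> I)"
  (is "_ \<longleftrightarrow> ?R")
proof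
  assume "ideal I (alg_ring T)"
  then interpret ideal I "alg_ring T" .
  show ?R using a_subset I_l_closed I_r_closed additive_subgroup.a_closed[OF is_additive_subgroup]
      additive_subgroup.zero_closed[OF is_additive_subgroup] by auto
next
  assume I: ?R
  show "ideal I (alg_ring T)"
  proof (rule idealI[OF ring_alg_ring])
    show "subgroup I (add_monoid (alg_ring T))"
    proof (rule group.subgroupI)
      show "group (add_monoid (alg_ring T :: (monom \<Rightarrow>\<^sub>0 'k) ring))"
        using ring_alg_ring abelian_group.a_group ring.is_abelian_group by blast
      fix a assume a: "a \<in> I"
      have "- 1 * a \<in> I" using I a alg_uminus[OF alg_1] by blast
      then have "- a \<in> I" by simp
      moreover have "inv\<^bsub>add_monoid (alg_ring T)\<^esub> a = - a"
        by (rule group.inv_equality) (use I a \<open>group (add_monoid (alg_ring T))\<close> in auto)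
      ultimately show "inv\<^bsub>add_monoid (alg_ring T)\<^esub> a \<in> I" by simp
    qed (use I in auto)
  qed (use I in auto)
qed

lemma nc_prime_ideal_alg_ring_iff:
  assumes "finite T"
  shows "nc_prime_ideal P (alg_ring T :: (monom \<Rightarrow>\<^sub>0 'k::field) ring) \<longleftrightarrow> alg_prime T P"
proof
  assume prime: "nc_prime_ideal P (alg_ring T)"
  then have "ideal P (alg_ring T)" and neq: "P \<noteq> alg T" by (auto simp: nc_prime_ideal_def)
  then have P: "P \<subseteq> alg T" "0 \<in> P" "\<And>a b. a \<in> P \<Longrightarrow> b \<in> P \<Longrightarrow> a + b \<in> P"
    "\<And>a s. a \<in> P \<Longrightarrow> s \<in> alg T \<Longrightarrow> s * a \<in> P" "\<And>a s. a \<in> P \<Longrightarrow> s \<in> alg T \<Longrightarrow> a * s \<in> P"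
    unfolding ideal_alg_ring_iff by blast+
  show "alg_prime T P"
  proof (unfold_locales; (intro P assms; assumption)?)
    show "1 \<notin> P" using P(1) P(4)[of 1] neq by auto
    fix a b :: "monom \<Rightarrow>\<^sub>0 'k"
    assume a: "a \<in> alg T" and b: "b \<in> alg T" and ab: "\<And>s. s \<in> alg T \<Longrightarrow> a * s * b \<in> P"
    \<comment> \<open>Instead of the ideals generated by \<open>a\<close> and \<open>b\<close>, take
      the larger residual ideals: \<open>I\<close> multiplies \<open>b\<close> into \<open>P\<close>
      from the left through every \<open>s\<close>, and \<open>J\<close> is multiplied into
      \<open>P\<close> by all of \<open>I\<close>. Both are two-sided, contain \<open>a\<close> and
      \<open>b\<close> respectively, and have product inside \<open>P\<close>, without any
      description of generated ideals.\<close>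
    define I where "I = {u \<in> alg T. \<forall>s\<in>alg T. u * s * b \<in> P}"
    define J where "J = {v \<in> alg T. \<forall>u\<in>I. \<forall>s\<in>alg T. u * s * v \<in> P}"
    have I: "ideal I (alg_ring T)"
      unfolding ideal_alg_ring_iff
    proof (intro conjI ballI)
      fix u s :: "monom \<Rightarrow>\<^sub>0 'k" assume "u \<in> I" and s: "s \<in> alg T"
      then have u: "u \<in> alg T" "\<And>s. s \<in> alg T \<Longrightarrow> u * s * b \<in> P" by (auto simp: I_def)
      have "s * (u * t * b) \<in> P" "u * (s * t) * b \<in> P" if "t \<in> alg T" for t
        using P(4)[OF u(2)[OF that] s] u(2)[OF alg_mult[OF s that]] by auto
      with u(1) s show "s * u \<in> I" "u * s \<in> I" by (auto simp: I_def mult.assoc)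
    qed (auto simp: I_def P distrib_right)
    have J: "ideal J (alg_ring T)"
      unfolding ideal_alg_ring_iff
    proof (intro conjI ballI)
      fix v s :: "monom \<Rightarrow>\<^sub>0 'k" assume "v \<in> J" and s: "s \<in> alg T"
      then have v: "v \<in> alg T" "\<And>u s. u \<in> I \<Longrightarrow> s \<in> alg T \<Longrightarrow> u * s * v \<in> P" by (auto simp: J_def)
      have "u * t * v * s \<in> P" "u * (t * s) * v \<in> P" if "u \<in> I" "t \<in> alg T" for u t
        using P(5)[OF v(2)[OF that] s] v(2)[OF that(1) alg_mult[OF that(2) s]] by auto
      with v(1) s show "s * v \<in> J" "v * s \<in> J" by (auto simp: J_def mult.assoc)
    qed (auto simp: J_def P distrib_left)
    have "ideal_prod (alg_ring T) I J \<subseteq> P"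
    proof
      fix x assume "x \<in> ideal_prod (alg_ring T) I J"
      then show "x \<in> P"
      proof (induction rule: ideal_prod.induct)
        case (prod i j)
        then have "i * 1 * j \<in> P" unfolding J_def using alg_1 by blast
        then show ?case by simp
      qed (simp add: P)
    qed
    with prime I J have "I \<subseteq> P \<or> J \<subseteq> P" unfolding nc_prime_ideal_def by blast
    moreover have "a \<in> I" using a ab by (auto simp: I_def)
    moreover have "b \<in> J" using b by (auto simp: J_def I_def)
    ultimately show "a \<in> P \<or> b \<in> P" by blast
  qed
next
  assume "alg_prime T P"
  then interpret alg_prime T P .
  have "ideal P (alg_ring T)"
    unfolding ideal_alg_ring_iff using P_sub P_0 P_add P_lmult P_rmult by blast
  moreover have "P \<noteq> carrier (alg_ring T)" using one_notin_P alg_1 by auto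
  moreover have "I \<subseteq> P \<or> J \<subseteq> P"
    if I: "ideal I (alg_ring T)" and J: "ideal J (alg_ring T)" and IJ: "ideal_prod (alg_ring T) I J \<subseteq> P" for I J
  proof (rule ccontr)
    assume "\<not> (I \<subseteq> P \<or> J \<subseteq> P)"
    then obtain a b where ab: "a \<in> I" "a \<notin> P" "b \<in> J" "b \<notin> P" by blast
    have "a \<in> alg T" "b \<in> alg T" using I J ab unfolding ideal_alg_ring_iff by blast+
    moreover have "a * s * b \<in> P" if "s \<in> alg T" for s
    proof -
      have "a * s \<in> I" using I ab(1) that unfolding ideal_alg_ring_iff by blast
      from ideal_prod.prod[OF this ab(3), of "alg_ring T"] IJ show ?thesis by auto
    qed
    ultimately show False using P_prime ab by blast
  qed
  ultimately show "nc_prime_ideal P (alg_ring T)" unfolding nc_prime_ideal_def by blast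
qed

lemma classical_krull_dim_alg_ring:
  "classical_krull_dim (alg_ring {1..n} :: (monom \<Rightarrow>\<^sub>0 'k::field) ring) = enat (2 * n)"
proof (rule antisym)
  show "classical_krull_dim (alg_ring {1..n} :: (monom \<Rightarrow>\<^sub>0 'k::field) ring) \<le> enat (2 * n)"
    unfolding classical_krull_dim_def
  proof (rule Sup_least, clarify)
    fix s and P :: "nat \<Rightarrow> (monom \<Rightarrow>\<^sub>0 'k) set"
    assume "\<forall>i\<le>s. nc_prime_ideal (P i) (alg_ring {1..n})" "\<forall>i<s. P i \<subset> P (Suc i)"
    then show "enat s \<le> enat (2 * n)"
      using alg_prime_chain_length[of s "{1..n}" P] by (simp add: nc_prime_ideal_alg_ring_iff)
  qed
  have "\<exists>P :: nat \<Rightarrow> (monom \<Rightarrow>\<^sub>0 'k) set. (\<forall>i\<le>2 * n. nc_prime_ideal (P i) (alg_ring {1..n})) \<and>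
      (\<forall>i<2 * n. P i \<subset> P (Suc i))"
    using exists_alg_prime_chain[of n] by (simp add: nc_prime_ideal_alg_ring_iff)
  then show "enat (2 * n) \<le> classical_krull_dim (alg_ring {1..n} :: (monom \<Rightarrow>\<^sub>0 'k::field) ring)"
    unfolding classical_krull_dim_def by (intro Sup_upper) blast
qed

section \<open>Normal forms in the presented algebra\<close>

text \<open>The wrapper lets concatenation be the monoid addition of a type, so that the free
  algebra becomes a monoid algebra and inherits its ring laws.\<close>

datatype word = Word (unword: "gen list")

instantiation word :: monoid_add
begin

definition "0 = Word []"

fun plus_word :: "word \<Rightarrow> word \<Rightarrow> word" where
  "Word u + Word v = Word (u @ v)"

instance
proof
  fix p q r :: word
  show "p + q + r = p + (q + r)" by (cases p; cases q; cases r) auto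
  show "0 + p = p" "p + 0 = p" by (cases p; simp add: zero_word_def)+
qed

end

definition words :: "nat \<Rightarrow> word set" where "words n = {k. set (unword k) \<subseteq> letters n}"

definition word_fun :: "(word \<Rightarrow>\<^sub>0 'k::field) \<Rightarrow> gen list \<Rightarrow> 'k" where
  "word_fun p = (\<lambda>w. lookup p (Word w))"

definition fun_word :: "(gen list \<Rightarrow> 'k::field) \<Rightarrow> (word \<Rightarrow>\<^sub>0 'k)" where
  "fun_word f = Abs_poly_mapping (\<lambda>k. f (unword k))"

lemma fun_word_word_fun [simp]: "fun_word (word_fun p) = p"
  by (simp add: fun_word_def word_fun_def)

lemma word_fun_add: "word_fun (p + q) = (\<lambda>w. word_fun p w + word_fun q w)"
  by (simp add: word_fun_def lookup_add)

text \<open>Both sides are biadditive, and for two single words \<open>u\<close> and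
  \<open>v\<close> only the cut of \<open>u @ v\<close> after \<open>length u\<close>
  contributes.\<close>

lemma word_fun_mult:
  "word_fun (p * q) = (\<lambda>w. \<Sum>i\<le>length w. word_fun p (take i w) * word_fun q (drop i w))"
proof
  fix w
  have "keys p \<subseteq> UNIV" by simp
  then show "word_fun (p * q) w = (\<Sum>i\<le>length w. word_fun p (take i w) * word_fun q (drop i w))"
  proof (induction rule: keys_induct)
    case (single k c)
    have "keys q \<subseteq> UNIV" by simp
    then show ?case
    proof (induction rule: keys_induct)
      case (single l d)
      obtain u v where kl: "k = Word u" "l = Word v" by (cases k; cases l)
      have "(\<Sum>i\<le>length w. word_fun (single k c) (take i w) * word_fun (single l d) (drop i w))
          = (\<Sum>i\<le>length w. if i = length u then (if w = u @ v then c * d else 0) else 0)"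
      proof (rule sum.cong)
        fix i assume "i \<in> {..length w}"
        then have "take i w = u \<and> drop i w = v \<longleftrightarrow> i = length u \<and> w = u @ v"
          by (metis append_eq_conv_conj append_take_drop_id atMost_iff length_take min.absorb2)
        then show "word_fun (single k c) (take i w) * word_fun (single l d) (drop i w)
            = (if i = length u then (if w = u @ v then c * d else 0) else 0)"
          unfolding word_fun_def lookup_single when_def kl by (cases "take i w = u"; cases "drop i w = v") auto
      qed simp
      also have "\<dots> = word_fun (single k c * single l d) w"
        by (simp add: word_fun_def mult_single lookup_single when_def kl eq_commute[of "u @ v"])
      finally show ?case ..
    next
      case (add a b)
      then show ?case by (simp add: word_fun_add distrib_left sum.distrib)
    qed (simp add: word_fun_def)
  next
    case (add a b)
    then show ?case by (simp add: word_fun_add distrib_right sum.distrib)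
  qed (simp add: word_fun_def)
qed

definition walg :: "nat \<Rightarrow> (word \<Rightarrow>\<^sub>0 'k::field) set" where
  "walg n = {p. keys p \<subseteq> words n}"

lemma words_0 [simp]: "0 \<in> words n"
  by (simp add: words_def zero_word_def)

lemma words_add: "k \<in> words n \<Longrightarrow> l \<in> words n \<Longrightarrow> k + l \<in> words n"
  by (cases k; cases l) (auto simp: words_def)

lemma walg_single [intro]: "k \<in> words n \<Longrightarrow> single k c \<in> walg n"
  by (simp add: walg_def)

lemma walg_0 [simp]: "0 \<in> walg n" and walg_1 [simp]: "1 \<in> walg n"
  by (auto simp: walg_def simp flip: single_one)

lemma walg_add [intro]: "p \<in> walg n \<Longrightarrow> q \<in> walg n \<Longrightarrow> p + q \<in> walg n"
  using keys_add[of p q] by (auto simp: walg_def)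

lemma walg_uminus [intro]: "p \<in> walg n \<Longrightarrow> - p \<in> walg n"
  by (auto simp: walg_def keys_uminus)

lemma walg_diff [intro]: "p \<in> walg n \<Longrightarrow> q \<in> walg n \<Longrightarrow> p - q \<in> walg n"
  using walg_add[of p n "- q"] by auto

lemma walg_mult [intro]: "p \<in> walg n \<Longrightarrow> q \<in> walg n \<Longrightarrow> p * q \<in> walg n"
  using keys_mult[of p q] by (auto simp: walg_def intro!: words_add)

lemma carrier_free_alg: "carrier (free_alg n) = word_fun ` (walg n :: (word \<Rightarrow>\<^sub>0 'k::field) set)"
proof (intro equalityI subsetI)
  fix f :: "gen list \<Rightarrow> 'k" assume "f \<in> carrier (free_alg n)"
  then have f: "finite {w. f w \<noteq> 0}" "\<And>w. f w \<noteq> 0 \<Longrightarrow> set w \<subseteq> letters n"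
    by (auto simp: free_alg_def)
  have "{k. f (unword k) \<noteq> 0} \<subseteq> Word ` {w. f w \<noteq> 0}"
    by (auto intro!: image_eqI[of _ _ "unword _"])
  then have "finite {k. f (unword k) \<noteq> 0}" using f(1) finite_surj by blast
  then have l: "lookup (fun_word f) k = f (unword k)" for k
    by (simp add: fun_word_def)
  then have "word_fun (fun_word f) = f" by (simp add: word_fun_def)
  moreover have "fun_word f \<in> walg n"
    unfolding walg_def words_def by (intro CollectI subsetI f(2)) (simp add: in_keys_iff l)
  ultimately show "f \<in> word_fun ` walg n" by (metis imageI)
next
  fix f :: "gen list \<Rightarrow> 'k" assume "f \<in> word_fun ` walg n"
  then obtain p where p: "keys p \<subseteq> words n" "f = word_fun p" by (auto simp: walg_def)
  have "{w. f w \<noteq> 0} \<subseteq> unword ` keys p"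
    by (auto simp: p word_fun_def in_keys_iff intro!: image_eqI[of _ _ "Word _"])
  then have "finite {w. f w \<noteq> 0}" by (rule finite_surj[OF finite_keys])
  moreover have "set w \<subseteq> letters n" if "f w \<noteq> 0" for w
  proof -
    have "Word w \<in> keys p" using that by (simp add: p(2) word_fun_def in_keys_iff)
    with p(1) have "Word w \<in> words n" by blast
    then show ?thesis by (simp add: words_def)
  qed
  ultimately show "f \<in> carrier (free_alg n)" by (simp add: free_alg_def)
qed

lemma free_alg_word_fun [simp]:
  "word_fun p \<otimes>\<^bsub>free_alg n\<^esub> word_fun q = word_fun (p * q)"
  "word_fun p \<oplus>\<^bsub>free_alg n\<^esub> word_fun q = word_fun (p + q)"
  by (simp_all add: free_alg_def word_fun_mult word_fun_add)

lemma free_alg_one: "\<one>\<^bsub>free_alg n\<^esub> = word_fun 1" and free_alg_zero: "\<zero>\<^bsub>free_alg n\<^esub> = word_fun 0"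
  by (auto simp: free_alg_def word_fun_def lookup_one when_def zero_word_def fun_eq_iff)

lemma ring_free_alg: "ring (free_alg n :: (gen list \<Rightarrow> 'k::field) ring)"
proof (intro ringI abelian_groupI monoidI)
  fix x :: "gen list \<Rightarrow> 'k"
  assume "x \<in> carrier (free_alg n)"
  then obtain p where "p \<in> walg n" "x = word_fun p" by (auto simp: carrier_free_alg)
  then show "\<exists>y\<in>carrier (free_alg n). y \<oplus>\<^bsub>free_alg n\<^esub> x = \<zero>\<^bsub>free_alg n\<^esub>"
    by (intro bexI[of _ "word_fun (- p)"]) (auto simp: carrier_free_alg free_alg_zero)
qed (auto simp: carrier_free_alg free_alg_one free_alg_zero algebra_simps)

lemma free_alg_minus:
  assumes "p \<in> walg n" "q \<in> walg n"
  shows "word_fun p \<ominus>\<^bsub>free_alg n\<^esub> word_fun q = (word_fun (p - q) :: gen list \<Rightarrow> 'k::field)"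
proof -
  interpret ring "free_alg n :: (gen list \<Rightarrow> 'k) ring" by (rule ring_free_alg)
  have "\<ominus>\<^bsub>free_alg n\<^esub> word_fun q = word_fun (- q)"
    by (rule minus_equality) (use assms in \<open>auto simp: carrier_free_alg free_alg_zero\<close>)
  then show ?thesis by (simp add: a_minus_def)
qed

section \<open>Evaluation of words in the monoid algebra\<close>

fun letter_monom :: "gen \<Rightarrow> monom" where
  "letter_monom (X i) = loc i (Bic 1 0)"
| "letter_monom (Y i) = loc i (Bic 0 1)"

fun word_monom :: "gen list \<Rightarrow> monom" where
  "word_monom [] = 0"
| "word_monom (l # w) = letter_monom l + word_monom w"

lemma word_monom_append: "word_monom (u @ v) = word_monom u + word_monom v"
  by (induction u) (simp_all add: add.assoc)

lemma word_monom_Mon: "set w \<subseteq> letters n \<Longrightarrow> word_monom w \<in> Mon {1..n}"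
  by (induction w) (auto simp: letters_def intro!: Mon_add loc_Mon)

definition word_coef :: "word \<Rightarrow> 'k::field \<Rightarrow> (monom \<Rightarrow>\<^sub>0 'k)" where
  "word_coef k c = single (word_monom (unword k)) c"

interpretation wm: ring_ext "word_coef :: word \<Rightarrow> 'k::field \<Rightarrow> _"
proof
  fix k l :: word and c d :: 'k
  show "word_coef (k + l) (c * d) = word_coef k c * word_coef l d"
    by (cases k; cases l) (simp add: word_coef_def mult_single word_monom_append)
qed (simp_all add: word_coef_def single_add zero_word_def)

lemma wm_lin_single: "wm.lin (single (Word w) c) = single (word_monom w) c"
  by (simp only: wm.lin_single word_coef_def word.sel)

declare wm.lin_single [simp del]

definition to_alg :: "(gen list \<Rightarrow> 'k::field) \<Rightarrow> (monom \<Rightarrow>\<^sub>0 'k)" where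
  "to_alg f = wm.lin (fun_word f)"

lemma to_alg_word_fun [simp]: "to_alg (word_fun p) = wm.lin p"
  by (simp add: to_alg_def)

lemma wm_lin_alg: "p \<in> walg n \<Longrightarrow> wm.lin p \<in> alg {1..n}"
  unfolding wm.lin_def word_coef_def
  by (intro alg_sum alg_single word_monom_Mon) (auto simp: walg_def words_def)

definition block :: "nat \<Rightarrow> bic \<Rightarrow> gen list" where
  "block i q = (case q of Bic a b \<Rightarrow> replicate a (X i) @ replicate b (Y i))"

text \<open>A section of \<open>word_monom\<close> over \<open>Mon {1..n}\<close>: the blocks x_i^a
  y_i^b are written in the order of the indices 1 to n.\<close>

definition nf :: "nat \<Rightarrow> monom \<Rightarrow> gen list" where
  "nf n m = concat (map (\<lambda>i. block i (m i)) [1..<Suc n])"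

lemma loc_0: "loc i (Bic 0 0) = 0"
  by (auto simp: loc_def zero_bic_def fun_eq_iff)

lemma word_monom_block: "word_monom (block i q) = loc i q"
proof -
  have "word_monom (replicate a (X i)) = loc i (Bic a 0)" for a
    by (induction a) (auto simp: loc_add loc_0)
  moreover have "word_monom (replicate b (Y i)) = loc i (Bic 0 b)" for b
    by (induction b) (auto simp: loc_add loc_0)
  ultimately show ?thesis by (cases q) (simp add: block_def word_monom_append loc_add)
qed

lemma word_monom_nf:
  assumes "m \<in> Mon {1..n}"
  shows "word_monom (nf n m) = m"
proof -
  have "word_monom (nf k m) = restr {1..k} m" for k
  proof (induction k)
    case 0
    show ?case by (simp add: nf_def restr_def zero_fun_def)
  next
    case (Suc k)
    have "word_monom (nf (Suc k) m) = restr {1..k} m + loc (Suc k) (m (Suc k))"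
      using Suc by (simp add: nf_def word_monom_append word_monom_block)
    also have "\<dots> = restr {1..Suc k} m"
      by (auto simp: restr_def loc_def fun_eq_iff)
    finally show ?case .
  qed
  then show ?thesis using restr_id[OF assms] by simp
qed

lemma set_block: "1 \<le> i \<Longrightarrow> i \<le> n \<Longrightarrow> set (block i q) \<subseteq> letters n"
  by (cases q) (auto simp: block_def letters_def)

lemma set_concat_blocks: "set is \<subseteq> {1..n} \<Longrightarrow> set (concat (map (\<lambda>i. block i (m i)) is)) \<subseteq> letters n"
proof
  fix l assume "set is \<subseteq> {1..n}" "l \<in> set (concat (map (\<lambda>i. block i (m i)) is))"
  then obtain i where "i \<in> {1..n}" "l \<in> set (block i (m i))" by auto
  then show "l \<in> letters n" using set_block[of i n "m i"] by auto
qed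

lemma set_nf: "set (nf n m) \<subseteq> letters n"
  unfolding nf_def by (rule set_concat_blocks) auto

fun index :: "gen \<Rightarrow> nat" where
  "index (X i) = i" | "index (Y i) = i"

lemma index_block: "l \<in> set (block i q) \<Longrightarrow> index l = i"
  by (cases q) (auto simp: block_def split: if_splits)

lemma to_alg_hom: "ring_hom_ring (free_alg n) (alg_ring {1..n}) (to_alg :: (gen list \<Rightarrow> 'k::field) \<Rightarrow> _)"
  by (rule ring_hom_ringI[OF ring_free_alg ring_alg_ring])
    (auto simp: carrier_free_alg free_alg_one wm_lin_alg wm.lin_mult wm.lin_add simp del: One_nat_def)

lemma to_alg_surj: "to_alg ` carrier (free_alg n) = (alg {1..n} :: (monom \<Rightarrow>\<^sub>0 'k::field) set)"
proof (intro equalityI subsetI)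
  fix a :: "monom \<Rightarrow>\<^sub>0 'k" assume "a \<in> alg {1..n}"
  then have "\<exists>p\<in>walg n. a = wm.lin p"
  proof (induction rule: alg_induct)
    case zero
    show ?case by (rule bexI[of _ 0]) auto
  next
    case (single m c)
    then show ?case using set_nf[of n m]
      by (intro bexI[of _ "single (Word (nf n m)) c"]) (auto simp: wm_lin_single word_monom_nf words_def simp del: One_nat_def)
  next
    case (add a b)
    then show ?case by (metis walg_add wm.lin_add)
  qed
  then show "a \<in> to_alg ` carrier (free_alg n)" by (force simp: carrier_free_alg image_image)
qed (auto simp: carrier_free_alg wm_lin_alg simp del: One_nat_def)

text \<open>The ideal of relations carried over to \<open>word \<Rightarrow>\<^sub>0 'k\<close>,
  where ordinary ring arithmetic applies.\<close>

definition rel_ideal :: "nat \<Rightarrow> (word \<Rightarrow>\<^sub>0 'k::field) set" where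
  "rel_ideal n = {p \<in> walg n. word_fun p \<in> genideal (free_alg n) (S_rels n)}"

abbreviation wd :: "gen list \<Rightarrow> (word \<Rightarrow>\<^sub>0 'k::field)" where "wd w \<equiv> single (Word w) 1"

lemma wd_mult: "wd u * wd v = wd (u @ v)" by (simp add: mult_single)

lemma wd_walg: "set w \<subseteq> letters n \<Longrightarrow> wd w \<in> walg n" by (auto simp: words_def)

lemma wd_Nil: "wd [] = 1" by (simp flip: single_one zero_word_def)

lemma gen_el_eq: "gen_el a = word_fun (wd [a])"
  by (auto simp: gen_el_def word_fun_def lookup_single when_def fun_eq_iff)

lemma X_letters: "1 \<le> i \<Longrightarrow> i \<le> n \<Longrightarrow> X i \<in> letters n"
  and Y_letters: "1 \<le> i \<Longrightarrow> i \<le> n \<Longrightarrow> Y i \<in> letters n"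
  by (auto simp: letters_def)

lemma Collect_image:
  assumes "\<And>i. Q i \<Longrightarrow> F i = h (G i)"
  shows "{F i | i. Q i} = h ` {G i | i. Q i}"
  using assms by (auto simp: image_def) metis

lemma Collect_image2:
  assumes "\<And>i j. Q i j \<Longrightarrow> F i j = h (G i j)"
  shows "{F i j | i j. Q i j} = h ` {G i j | i j. Q i j}"
  using assms by (auto simp: image_def) metis

lemma S_rels_eq:
  "(S_rels n :: (gen list \<Rightarrow> 'k::field) set) = word_fun `
     ({wd [Y i, X i] - 1 | i. 1 \<le> i \<and> i \<le> n}
    \<union> {wd [X i, Y j] - wd [Y j, X i] | i j. 1 \<le> i \<and> i \<le> n \<and> 1 \<le> j \<and> j \<le> n \<and> i \<noteq> j}
    \<union> {wd [X i, X j] - wd [X j, X i] | i j. 1 \<le> i \<and> i \<le> n \<and> 1 \<le> j \<and> j \<le> n \<and> i \<noteq> j}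
    \<union> {wd [Y i, Y j] - wd [Y j, Y i] | i j. 1 \<le> i \<and> i \<le> n \<and> 1 \<le> j \<and> j \<le> n \<and> i \<noteq> j})"
proof -
  have c: "commutator (free_alg n) (gen_el a) (gen_el b) = (word_fun (wd [a, b] - wd [b, a]) :: gen list \<Rightarrow> 'k)"
    if "a \<in> letters n" "b \<in> letters n" for a b
    unfolding commutator_def gen_el_eq free_alg_word_fun wd_mult append.simps
    by (rule free_alg_minus) (use that in \<open>auto simp: words_def\<close>)
  have u: "(gen_el (Y i) \<otimes>\<^bsub>free_alg n\<^esub> gen_el (X i)) \<ominus>\<^bsub>free_alg n\<^esub> \<one>\<^bsub>free_alg n\<^esub>
      = (word_fun (wd [Y i, X i] - 1) :: gen list \<Rightarrow> 'k)" if "1 \<le> i" "i \<le> n" for i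
    unfolding gen_el_eq free_alg_word_fun free_alg_one wd_mult append.simps
    by (rule free_alg_minus) (use that in \<open>auto simp: words_def letters_def\<close>)
  have 1: "{(gen_el (Y i) \<otimes>\<^bsub>free_alg n\<^esub> gen_el (X i)) \<ominus>\<^bsub>free_alg n\<^esub> \<one>\<^bsub>free_alg n\<^esub> | i. 1 \<le> i \<and> i \<le> n}
      = (word_fun ` {wd [Y i, X i] - 1 | i. 1 \<le> i \<and> i \<le> n} :: (gen list \<Rightarrow> 'k) set)"
    by (rule Collect_image) (simp add: u)
  have 2: "{commutator (free_alg n) (gen_el (f i)) (gen_el (g j)) | i j.
        1 \<le> i \<and> i \<le> n \<and> 1 \<le> j \<and> j \<le> n \<and> i \<noteq> j}
      = (word_fun ` {wd [f i, g j] - wd [g j, f i] | i j. 1 \<le> i \<and> i \<le> n \<and> 1 \<le> j \<and> j \<le> n \<and> i \<noteq> j}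
        :: (gen list \<Rightarrow> 'k) set)"
    if "\<And>i. 1 \<le> i \<Longrightarrow> i \<le> n \<Longrightarrow> f i \<in> letters n \<and> g i \<in> letters n" for f g
  proof -
    have "commutator (free_alg n) (gen_el (f i)) (gen_el (g j)) = (word_fun (wd [f i, g j] - wd [g j, f i]) :: gen list \<Rightarrow> 'k)"
      if "1 \<le> i \<and> i \<le> n \<and> 1 \<le> j \<and> j \<le> n \<and> i \<noteq> j" for i j
      using c \<open>\<And>i. 1 \<le> i \<Longrightarrow> i \<le> n \<Longrightarrow> f i \<in> letters n \<and> g i \<in> letters n\<close> that by blast
    then show ?thesis by (rule Collect_image2)
  qed
  show ?thesis unfolding S_rels_def 1 image_Un
    using 2[of X Y] 2[of X X] 2[of Y Y] X_letters Y_letters by simp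
qed

section \<open>Words modulo the relations\<close>

context
  fixes n :: nat
begin

lemma S_rels_carrier: "S_rels n \<subseteq> (carrier (free_alg n) :: (gen list \<Rightarrow> 'k::field) set)"
  unfolding S_rels_eq carrier_free_alg
  by (intro image_mono) (auto intro!: walg_diff walg_single simp: words_def X_letters Y_letters)

lemma ideal_genideal_S_rels: "ideal (genideal (free_alg n) (S_rels n)) (free_alg n :: (gen list \<Rightarrow> 'k::field) ring)"
  by (rule ring.genideal_ideal[OF ring_free_alg S_rels_carrier])

lemma rel_ideal_0: "0 \<in> rel_ideal n"
  using additive_subgroup.zero_closed[OF ideal.axioms(1)[OF ideal_genideal_S_rels]]
  by (simp add: rel_ideal_def free_alg_zero)

lemma rel_ideal_add:
  assumes "p \<in> rel_ideal n" "q \<in> rel_ideal n"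
  shows "p + q \<in> rel_ideal n"
  using additive_subgroup.a_closed[OF ideal.axioms(1)[OF ideal_genideal_S_rels], of "word_fun p" "word_fun q"] assms
  by (auto simp: rel_ideal_def)

lemma rel_ideal_mult:
  assumes "p \<in> rel_ideal n" "s \<in> walg n"
  shows "s * p \<in> rel_ideal n" "p * s \<in> rel_ideal n"
  using ideal.I_l_closed[OF ideal_genideal_S_rels, of "word_fun p" "word_fun s"]
    ideal.I_r_closed[OF ideal_genideal_S_rels, of "word_fun p" "word_fun s"] assms
  by (auto simp: rel_ideal_def carrier_free_alg)

lemma rel_ideal_uminus: "p \<in> rel_ideal n \<Longrightarrow> - p \<in> rel_ideal n"
  using rel_ideal_mult(1)[OF _ walg_uminus[OF walg_1], of p] by simp

lemma S_rels_rel_ideal: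
  assumes "word_fun p \<in> S_rels n" "p \<in> walg n"
  shows "p \<in> rel_ideal n"
  using assms ring.genideal_self[OF ring_free_alg S_rels_carrier] by (auto simp: rel_ideal_def)

text \<open>The type argument fixes the coefficient field, which the words themselves do not
  determine.\<close>

definition wcong :: "'k::field itself \<Rightarrow> gen list \<Rightarrow> gen list \<Rightarrow> bool" where
  "wcong _ u v \<longleftrightarrow> wd u - wd v \<in> (rel_ideal n :: (word \<Rightarrow>\<^sub>0 'k) set)"

lemma wcong_refl: "wcong K u u" by (simp add: wcong_def rel_ideal_0)

lemma wcong_sym: "wcong K u v \<Longrightarrow> wcong K v u"
  unfolding wcong_def using rel_ideal_uminus by fastforce

lemma wcong_trans [trans]: "wcong K u v \<Longrightarrow> wcong K v w \<Longrightarrow> wcong K u w"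
  unfolding wcong_def using rel_ideal_add by fastforce

lemma wcong_context:
  assumes "wcong (K :: 'k::field itself) u v" "set a \<subseteq> letters n" "set b \<subseteq> letters n"
  shows "wcong K (a @ u @ b) (a @ v @ b)"
proof -
  have "wd a * (wd u - wd v) * wd b \<in> (rel_ideal n :: (word \<Rightarrow>\<^sub>0 'k) set)"
    using assms by (intro rel_ideal_mult wd_walg) (simp_all add: wcong_def)
  then show ?thesis by (simp add: wcong_def algebra_simps wd_mult)
qed

lemma wcong_cancel:
  assumes "1 \<le> i" "i \<le> n"
  shows "wcong (K :: 'k::field itself) [Y i, X i] []"
  unfolding wcong_def wd_Nil
proof (rule S_rels_rel_ideal)
  show "word_fun (wd [Y i, X i] - 1) \<in> (S_rels n :: (gen list \<Rightarrow> 'k) set)"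
    unfolding S_rels_eq using assms by blast
  show "wd [Y i, X i] - 1 \<in> (walg n :: (word \<Rightarrow>\<^sub>0 'k) set)"
    using assms by (intro walg_diff wd_walg walg_1) (auto simp: letters_def)
qed

lemma wcong_swap:
  assumes "l \<in> letters n" "l' \<in> letters n" "index l \<noteq> index l'"
  shows "wcong (K :: 'k::field itself) [l, l'] [l', l]"
proof -
  have *: "wd [l, l'] - wd [l', l] \<in> (walg n :: (word \<Rightarrow>\<^sub>0 'k) set)"
    using assms by (intro walg_diff wd_walg) auto
  have "1 \<le> index l" "index l \<le> n" "1 \<le> index l'" "index l' \<le> n"
    using assms by (auto simp: letters_def)
  note ix = this assms(3)
  \<comment> \<open>The relations contain the commutators of x_i with y_j only in this order; the
    other order follows by symmetry.\<close>
  have XY: "wcong K [X i, Y j] [Y j, X i]"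
    if "1 \<le> i" "i \<le> n" "1 \<le> j" "j \<le> n" "i \<noteq> j" for i j
    unfolding wcong_def
  proof (rule S_rels_rel_ideal)
    show "word_fun (wd [X i, Y j] - wd [Y j, X i]) \<in> (S_rels n :: (gen list \<Rightarrow> 'k) set)"
      unfolding S_rels_eq using that by blast
    show "wd [X i, Y j] - wd [Y j, X i] \<in> (walg n :: (word \<Rightarrow>\<^sub>0 'k) set)"
      using that by (intro walg_diff wd_walg) (auto simp: letters_def)
  qed
  show ?thesis
  proof (cases l; cases l')
    fix i j assume l: "l = X i" "l' = X j"
    have "word_fun (wd [l, l'] - wd [l', l]) \<in> (S_rels n :: (gen list \<Rightarrow> 'k) set)"
      unfolding S_rels_eq l using ix unfolding l index.simps by blast
    then show ?thesis unfolding wcong_def using * by (rule S_rels_rel_ideal)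
  next
    fix i j assume l: "l = Y i" "l' = Y j"
    have "word_fun (wd [l, l'] - wd [l', l]) \<in> (S_rels n :: (gen list \<Rightarrow> 'k) set)"
      unfolding S_rels_eq l using ix unfolding l index.simps by blast
    then show ?thesis unfolding wcong_def using * by (rule S_rels_rel_ideal)
  next
    fix i j assume "l = X i" "l' = Y j"
    then show ?thesis using XY[of i j] ix by simp
  next
    fix i j assume "l = Y i" "l' = X j"
    then show ?thesis using wcong_sym[OF XY[of j i]] ix by simp
  qed
qed

lemma wcong_move:
  assumes "l \<in> letters n" "set u \<subseteq> letters n" "\<forall>l'\<in>set u. index l' \<noteq> index l"
  shows "wcong K (l # u) (u @ [l])"
  using assms(2,3)
proof (induction u)
  case Nil
  show ?case by (simp add: wcong_refl)
next
  case (Cons l' u)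
  have "wcong K ([] @ [l, l'] @ u) ([] @ [l', l] @ u)"
    using Cons.prems assms(1) by (intro wcong_context wcong_swap) auto
  also have "wcong K ([l'] @ (l # u) @ []) ([l'] @ (u @ [l]) @ [])"
    using Cons by (intro wcong_context) auto
  then have "wcong K ([] @ [l', l] @ u) ((l' # u) @ [l])" by simp
  finally show ?case by simp
qed

text \<open>A letter x_j lengthens the block. A letter y_j either cancels the first x_j by y_j x_j =
  1 or, if there is none, lengthens the power of y_j.\<close>

lemma wcong_block:
  assumes "l \<in> letters n" "index l = j"
  shows "wcong K (l # block j q) (block j (letter_monom l j + q))"
proof -
  have j: "1 \<le> j" "j \<le> n" using assms by (auto simp: letters_def)
  obtain a b where q: "q = Bic a b" by (cases q)
  show ?thesis
  proof (cases l)
    case (X i)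
    with assms(2) show ?thesis by (simp add: q block_def loc_def wcong_refl)
  next
    case (Y i)
    show ?thesis
    proof (cases a)
      case 0
      with Y assms(2) show ?thesis by (simp add: q block_def loc_def wcong_refl)
    next
      case (Suc a')
      have "wcong K ([] @ [Y j, X j] @ block j (Bic a' b)) ([] @ [] @ block j (Bic a' b))"
        using set_block[OF j] by (intro wcong_context wcong_cancel j) auto
      with Suc Y assms(2) show ?thesis by (simp add: q block_def loc_def)
    qed
  qed
qed

text \<open>The letter commutes past all blocks of smaller index and is absorbed by the block of its
  own index; the later blocks stay unchanged.\<close>

lemma wcong_letter_nf:
  assumes "l \<in> letters n"
  shows "wcong K (l # nf n m) (nf n (letter_monom l + m))"
proof -
  define j where "j = index l"
  have j: "1 \<le> j" "j \<le> n" using assms by (auto simp: j_def letters_def)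
  define A B where "A = (\<lambda>m. concat (map (\<lambda>i. block i (m i)) [1..<j]))"
    and "B = (\<lambda>m. concat (map (\<lambda>i. block i (m i)) [Suc j..<Suc n]))"
  have split: "[1..<Suc n] = [1..<j] @ j # [Suc j..<Suc n]"
  proof -
    have "[1..<Suc n] = [1..<j] @ [j..<Suc n]"
      using j upt_add_eq_append[of 1 j "Suc n - j"] by simp
    also have "[j..<Suc n] = j # [Suc j..<Suc n]" using j by (intro upt_conv_Cons) simp
    finally show ?thesis .
  qed
  have nf: "nf n m = A m @ block j (m j) @ B m" for m
    unfolding nf_def split A_def B_def by simp
  have off: "letter_monom l i = 0" if "i \<noteq> j" for i
    using that by (cases l) (auto simp: j_def loc_def)
  have AB: "A (letter_monom l + m) = A m" "B (letter_monom l + m) = B m"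
    unfolding A_def B_def by (auto simp: off intro!: arg_cong[where f = concat])
  have A: "set (A m) \<subseteq> letters n" "set (B m) \<subseteq> letters n"
    unfolding A_def B_def by (rule set_concat_blocks; use j in \<open>simp del: upt_Suc; auto\<close>)+
  have blk: "set (block j (m j)) \<subseteq> letters n" using set_block j by simp
  have "\<forall>l'\<in>set (A m). index l' \<noteq> index l"
    unfolding A_def j_def[symmetric] by (auto dest: index_block)
  then have "wcong K ([] @ (l # A m) @ (block j (m j) @ B m)) ([] @ (A m @ [l]) @ (block j (m j) @ B m))"
    using A blk by (intro wcong_context wcong_move assms) auto
  also have "[] @ (A m @ [l]) @ (block j (m j) @ B m) = A m @ (l # block j (m j)) @ B m" by simp
  also have "wcong K \<dots> (A m @ block j (letter_monom l j + m j) @ B m)"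
    using A by (intro wcong_context wcong_block assms) (auto simp: j_def)
  finally show ?thesis by (simp add: nf AB)
qed

lemma wcong_nf: "set w \<subseteq> letters n \<Longrightarrow> wcong K w (nf n (word_monom w))"
proof (induction w)
  case Nil
  have "nf n 0 = []" by (simp add: nf_def block_def zero_bic_def)
  then show ?case unfolding word_monom.simps by (simp only: wcong_refl)
next
  case (Cons l w)
  have "wcong K ([l] @ w @ []) ([l] @ nf n (word_monom w) @ [])"
    using Cons by (intro wcong_context) auto
  also have "wcong K ([l] @ nf n (word_monom w) @ []) (nf n (word_monom (l # w)))"
    using wcong_letter_nf[where K = K] Cons.prems by simp
  finally show ?case by (simp only: append.simps append_Nil2)
qed

text \<open>Extended additively only, since the concatenation of two normal forms need not be a
  normal form.\<close>

definition nf_coef :: "monom \<Rightarrow> 'k::field \<Rightarrow> (word \<Rightarrow>\<^sub>0 'k)" where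
  "nf_coef m c = single (Word (nf n m)) c"

interpretation nfe: additive_ext nf_coef
  by standard (simp add: nf_coef_def single_add)

lemma nfe_lin_single: "nfe.lin (single m c) = single (Word (nf n m)) c"
  by (simp only: nfe.lin_single nf_coef_def)

declare nfe.lin_single [simp del]

text \<open>By additivity this is the congruence of each word with its normal form. It shows that
  every element evaluating to 0 is a consequence of the relations.\<close>

lemma word_minus_nf_mem:
  assumes "p \<in> walg n"
  shows "p - nfe.lin (wm.lin p) \<in> (rel_ideal n :: (word \<Rightarrow>\<^sub>0 'k::field) set)"
proof -
  have "keys p \<subseteq> words n" using assms by (simp add: walg_def)
  then show ?thesis
  proof (induction rule: keys_induct)
    case zero
    show ?case by (simp add: rel_ideal_0)
  next
    case (single k c)
    obtain w where k: "k = Word w" by (cases k)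
    have "wcong TYPE('k) w (nf n (word_monom w))"
      using single by (intro wcong_nf) (simp add: k words_def)
    then have "single 0 c * (wd w - wd (nf n (word_monom w))) \<in> (rel_ideal n :: (word \<Rightarrow>\<^sub>0 'k) set)"
      unfolding wcong_def by (intro rel_ideal_mult) auto
    then show ?case
      by (simp add: k wm_lin_single nfe_lin_single algebra_simps mult_single flip: zero_word_def)
  next
    case (add a b)
    from rel_ideal_add[OF add] show ?case by (simp add: wm.lin_add nfe.lin_add algebra_simps)
  qed
qed

text \<open>If the value of \<open>p\<close> is 0, its normal form part vanishes and
  \<open>p\<close> itself lies in the ideal. Conversely the relations hold in the power of the
  bicyclic monoid, so the kernel, being an ideal, contains the ideal they generate.\<close>

lemma kernel_to_alg:
  "a_kernel (free_alg n) (alg_ring {1..n}) to_alg = (genideal (free_alg n) (S_rels n) :: (gen list \<Rightarrow> 'k::field) set)"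
proof (intro equalityI subsetI)
  fix f :: "gen list \<Rightarrow> 'k"
  assume "f \<in> a_kernel (free_alg n) (alg_ring {1..n}) to_alg"
  then obtain p where p: "p \<in> walg n" "f = word_fun p" "wm.lin p = 0"
    by (auto simp: a_kernel_def' carrier_free_alg)
  with word_minus_nf_mem[OF p(1)] show "f \<in> genideal (free_alg n) (S_rels n)"
    by (simp add: rel_ideal_def)
next
  fix f :: "gen list \<Rightarrow> 'k"
  assume f: "f \<in> genideal (free_alg n) (S_rels n)"
  interpret ring_hom_ring "free_alg n" "alg_ring {1..n}" "to_alg :: (gen list \<Rightarrow> 'k) \<Rightarrow> _"
    by (rule to_alg_hom)
  have "to_alg r = 0" if "r \<in> S_rels n" for r :: "gen list \<Rightarrow> 'k"
  proof -
    have comm: "letter_monom a + letter_monom b = letter_monom b + letter_monom a"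
      if "index a \<noteq> index b" for a b
      using that by (cases a; cases b) (auto simp: loc_def fun_eq_iff)
    have 1: "wm.lin (wd [a, b] - wd [b, a] :: word \<Rightarrow>\<^sub>0 'k) = 0" if "index a \<noteq> index b" for a b
      using comm[OF that] by (simp add: wm.lin_diff wm_lin_single)
    have "loc i (Bic 0 1) + loc i (Bic 1 0) = 0" for i
      by (simp add: loc_add) (simp add: loc_def zero_bic_def fun_eq_iff)
    then have "wm.lin (wd [Y i, X i] - 1 :: word \<Rightarrow>\<^sub>0 'k) = 0" for i
      by (simp add: wm.lin_diff wm_lin_single)
    then show ?thesis using that 1 unfolding S_rels_eq by auto
  qed
  then have "S_rels n \<subseteq> a_kernel (free_alg n) (alg_ring {1..n}) (to_alg :: (gen list \<Rightarrow> 'k) \<Rightarrow> _)"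
    using subsetD[OF S_rels_carrier] unfolding a_kernel_def' by (intro subsetI CollectI conjI) auto
  from R.genideal_minimal[OF kernel_is_ideal this] f
  show "f \<in> a_kernel (free_alg n) (alg_ring {1..n}) to_alg" by blast
qed

end

text \<open>The first isomorphism theorem for \<open>to_alg\<close>; a coset is sent to the common
  value of \<open>to_alg\<close> on it.\<close>

lemma ring_iso_S_alg:
  "(\<lambda>A. the_elem (to_alg ` A)) \<in> ring_iso (S_alg n) (alg_ring {1..n} :: (monom \<Rightarrow>\<^sub>0 'k::field) ring)"
  unfolding S_alg_def kernel_to_alg[symmetric]
  by (rule ring_hom_ring.FactRing_iso_set[OF to_alg_hom]) (simp only: to_alg_surj alg_ring_simps)

theorem theorem4p10:
  fixes n :: nat
  assumes "n \<ge> 1"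
  shows "classical_krull_dim (S_alg n :: (gen list \<Rightarrow> 'k::field) set ring) = enat (2 * n)"
proof -
  have "ring (S_alg n :: (gen list \<Rightarrow> 'k::field) set ring)"
    unfolding S_alg_def by (rule ideal.quotient_is_ring[OF ideal_genideal_S_rels])
  from classical_krull_dim_iso[OF this ring_alg_ring ring_iso_S_alg] show ?thesis
    by (simp only: classical_krull_dim_alg_ring)
qed

end
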